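(* Let $n\ge2$ be a fixed integer, and let $T_0\supset T_1\supset T_2\supset\cdots$ be the explicit nested sequence of longest-edge $n$-section descendants defined in the context. There exist a tetrahedral domain $\Omega\subset\mathbb R^3$ (the interior of a tetrahedron) and a nested sequence of conforming tetrahedral partitions $\{\mathcal T_m\}_{m\ge0}$ of $\Omega$, generated by the conforming LE $n$-section algorithm, such that $$h(\mathcal T_m)\longrightarrow 0\qquad(m\to\infty),$$ while the family $\{\mathcal T_m\}$ fails shape regularity and both angle conditions, that is: (i) there is no constant $C$ with $h_T/r_T\le C$ for all $m$ and all $T\in\mathcal T_m$; (ii) there is no constant $\alpha_0>0$ with $\theta\ge\alpha_0$ for all $m$, all $T\in\mathcal T_m$ and all $\theta\in\mathcal A(T)$; (iii) there is no constant $\alpha_1<\pi$ with $\theta\le\alpha_1$ for all $m$, all $T\in\mathcal T_m$ and all $\theta\in\mathcal A(T)$. Moreover, the family contains, at a subsequence of mesh stages, every member of the sequence $(T_k)$: there are indices $m_0<m_1<m_2<\cdots$ with $T_k\in\mathcal T_{m_k}$ for every $k\ge0$.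
   Context: A tetrahedron is the convex hull of four affinely independent points of $\mathbb R^3$. For a tetrahedron $T$: $h_T=\operatorname{diam}T$ (the length of its longest edge), $r_T$ is the inradius, and $\mathcal A(T)$ is the set of the twelve planar angles of its four triangular faces and its six interior dihedral angles. A tetrahedral partition $\mathcal T$ of a bounded polyhedral domain $\Omega$ is a finite collection of (closed nondegenerate) tetrahedra with pairwise disjoint interiors and union $\overline\Omega$. It is conforming if the intersection of any two distinct elements is empty or a complete common vertex, edge, or triangular face. $h(\mathcal T)=\max_{T\in\mathcal T}h_T$. A sequence of partitions is nested if every element of each partition lies in an element of the preceding one. Edge $n$-section: for $T=\operatorname{conv}\{A,B,C,D\}$ and its edge $e=AB$, put $P_j=(1-j/n)A+(j/n)B$ ($0\le j\le n$) and $\mathcal N_n(T,e)=\{\operatorname{conv}\{P_{j-1},P_j,C,D\}:1\le j\le n\}$. Conforming LE $n$-section algorithm: start from a finite conforming tetrahedral partition $\mathcal T_0$. Given $\mathcal T_m$, choose any edge $e_m$ of the mesh $\mathcal T_m$ whose length is maximal among all edges of all elements of $\mathcal T_m$ (so $|e_m|=h(\mathcal T_m)$), let $\omega_m(e_m)=\{T\in\mathcal T_m: e_m\text{ is an edge of }T\}$, and set $$\mathcal T_{m+1}=\bigl(\mathcal T_m\setminus\omega_m(e_m)\bigr)\cup\bigcup_{T\in\omega_m(e_m)}\mathcal N_n(T,e_m).$$ The explicit sequence $(T_k)$ for given $n$. The tetrahedra with even index carry an ordered labelling $(A,B,C,D)$ of their vertices. Initial tetrahedron $T_0=\operatorname{conv}\{A,B,C,D\}$: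 - If $2\le n\le5$, let $\Delta_n=n-\frac{(n-1)^2}{4}>0$ and $A=(0,0,1)$, $B=(0,0,0)$, $C=(1,0,0)$, $D=\bigl(\tfrac{n-1}{2},\sqrt{\Delta_n},0\bigr)$. - If $n\ge6$, let $p=\frac{n-1-\sqrt{n^2-6n+1}}{2n}$, $q=\frac{n-1+\sqrt{n^2-6n+1}}{2n}$ and $A=(0,0,1)$, $B=(0,0,0)$, $C=(p,q,0)$, $D=(1,1,0)$. Recursion: given $T_{2k}=\operatorname{conv}\{A,B,C,D\}$ with its labelling, put $$M=\frac{A+(n-1)D}{n},\qquad P=\frac{2B+(n-2)D}{n},\qquad N=\frac{B+(n-1)D}{n},$$ $$T_{2k+1}=\operatorname{conv}\{M,B,C,D\},\qquad T_{2k+2}=\operatorname{conv}\{M,N,P,C\},$$ where $T_{2k+2}$ is labelled by taking $(M,N,P,C)$ as its new $(A,B,C,D)$. (Thus $T_{2k+1}$ is a child of $T_{2k}$ under $n$-section of the edge $AD$, and $T_{2k+2}$ is a child of $T_{2k+1}$ under $n$-section of the edge $BD$; these edges are longest edges of the respective tetrahedra.) *)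

theory Defs
  imports "HOL-Analysis.Analysis"
begin

type_synonym pt = "real ^ 3"

abbreviation tetrahedron :: "pt set \<Rightarrow> bool" where
  "tetrahedron T \<equiv> 3 simplex T"

definition vertices :: "pt set \<Rightarrow> pt set" where
  "vertices T = {x. x extreme_point_of T}"

definition inradius :: "pt set \<Rightarrow> real" where
  "inradius T = Sup {r. 0 \<le> r \<and> (\<exists>c. cball c r \<subseteq> T)}"

definition vec_angle :: "pt \<Rightarrow> pt \<Rightarrow> real" where
  "vec_angle u v = arccos ((u \<bullet> v) / (norm u * norm v))"

(* Angle at B of the triangle A B C. *)
definition planar_angle :: "pt \<Rightarrow> pt \<Rightarrow> pt \<Rightarrow> real" where
  "planar_angle A B C = vec_angle (A - B) (C - B)"

definition orth_part :: "pt \<Rightarrow> pt \<Rightarrow> pt" where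
  "orth_part u w = w - ((w \<bullet> u) / (u \<bullet> u)) *\<^sub>R u"

(* Interior dihedral angle along the edge A B between the faces A B C and A B D:
   the angle between the directions, orthogonal to A B, in which these two
   half-planes leave the line A B. *)
definition dihedral_angle :: "pt \<Rightarrow> pt \<Rightarrow> pt \<Rightarrow> pt \<Rightarrow> real" where
  "dihedral_angle A B C D =
     vec_angle (orth_part (B - A) (C - A)) (orth_part (B - A) (D - A))"

definition angles :: "pt set \<Rightarrow> real set" where
  "angles T =
     {planar_angle A B C | A B C. {A, B, C} \<subseteq> vertices T \<and> distinct [A, B, C]} \<union>
     {dihedral_angle A B C D | A B C D. {A, B, C, D} \<subseteq> vertices T \<and> distinct [A, B, C, D]}"

(* The domain is an arbitrary set here; every \<Omega> that admits a partition has a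
   polyhedral closure. *)
definition tetrahedral_partition :: "pt set \<Rightarrow> pt set set \<Rightarrow> bool" where
  "tetrahedral_partition \<Omega> \<T> \<longleftrightarrow>
     finite \<T> \<and> (\<forall>T\<in>\<T>. tetrahedron T) \<and>
     (\<forall>S\<in>\<T>. \<forall>T\<in>\<T>. S \<noteq> T \<longrightarrow> interior S \<inter> interior T = {}) \<and>
     \<Union>\<T> = closure \<Omega>"

(* Affine dimension 0, 1, 2: a common vertex, edge, or triangular face. *)
definition conforming :: "pt set set \<Rightarrow> bool" where
  "conforming \<T> \<longleftrightarrow>
     (\<forall>S\<in>\<T>. \<forall>T\<in>\<T>. S \<noteq> T \<longrightarrow>
        S \<inter> T = {} \<or>
        (S \<inter> T) face_of S \<and> (S \<inter> T) face_of T \<and> aff_dim (S \<inter> T) \<in> {0, 1, 2})"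

definition mesh_size :: "pt set set \<Rightarrow> real" where
  "mesh_size \<T> = Max (diameter ` \<T>)"

definition nested :: "(nat \<Rightarrow> pt set set) \<Rightarrow> bool" where
  "nested \<T> \<longleftrightarrow> (\<forall>m. \<forall>S\<in>\<T> (Suc m). \<exists>T\<in>\<T> m. S \<subseteq> T)"

definition division_point :: "nat \<Rightarrow> pt \<Rightarrow> pt \<Rightarrow> nat \<Rightarrow> pt" where
  "division_point n A B j = (1 - real j / real n) *\<^sub>R A + (real j / real n) *\<^sub>R B"

(* A and B are the endpoints of an edge of the tetrahedron T, so that
   vertices T - {A, B} consists of the two remaining vertices C and D. *)
definition edge_section :: "nat \<Rightarrow> pt set \<Rightarrow> pt \<Rightarrow> pt \<Rightarrow> pt set set" where
  "edge_section n T A B =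
     {convex hull ({division_point n A B (j - 1), division_point n A B j} \<union> (vertices T - {A, B}))
       | j. 1 \<le> j \<and> j \<le> n}"

definition is_edge :: "pt \<Rightarrow> pt \<Rightarrow> pt set \<Rightarrow> bool" where
  "is_edge A B T \<longleftrightarrow> closed_segment A B edge_of T"

definition longest_mesh_edge :: "pt \<Rightarrow> pt \<Rightarrow> pt set set \<Rightarrow> bool" where
  "longest_mesh_edge A B \<T> \<longleftrightarrow>
     (\<exists>T\<in>\<T>. is_edge A B T) \<and>
     (\<forall>T\<in>\<T>. \<forall>A' B'. is_edge A' B' T \<longrightarrow> dist A' B' \<le> dist A B)"

definition edge_star :: "pt \<Rightarrow> pt \<Rightarrow> pt set set \<Rightarrow> pt set set" where
  "edge_star A B \<T> = {T \<in> \<T>. is_edge A B T}"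

definition LE_step :: "nat \<Rightarrow> pt set set \<Rightarrow> pt set set \<Rightarrow> bool" where
  "LE_step n \<T> \<T>' \<longleftrightarrow>
     (\<exists>A B. longest_mesh_edge A B \<T> \<and>
        \<T>' = (\<T> - edge_star A B \<T>) \<union> (\<Union>T\<in>edge_star A B \<T>. edge_section n T A B))"

(* The algorithm is nondeterministic (the longest edge need not be unique);
   this says that the sequence is one of its possible runs. *)
definition LE_algorithm_run :: "nat \<Rightarrow> pt set \<Rightarrow> (nat \<Rightarrow> pt set set) \<Rightarrow> bool" where
  "LE_algorithm_run n \<Omega> \<T> \<longleftrightarrow>
     tetrahedral_partition \<Omega> (\<T> 0) \<and> conforming (\<T> 0) \<and>
     (\<forall>m. LE_step n (\<T> m) (\<T> (Suc m)))"

definition initial_labelling :: "nat \<Rightarrow> pt \<times> pt \<times> pt \<times> pt" where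
  "initial_labelling n =
     (if n \<le> 5 then
        (vector [0, 0, 1],
         vector [0, 0, 0],
         vector [1, 0, 0],
         vector [(real n - 1) / 2, sqrt (real n - (real n - 1)\<^sup>2 / 4), 0])
      else
        (let s = sqrt ((real n)\<^sup>2 - 6 * real n + 1);
             p = (real n - 1 - s) / (2 * real n);
             q = (real n - 1 + s) / (2 * real n)
         in (vector [0, 0, 1],
             vector [0, 0, 0],
             vector [p, q, 0],
             vector [1, 1, 0])))"

definition point_M :: "nat \<Rightarrow> pt \<Rightarrow> pt \<Rightarrow> pt" where
  "point_M n A D = (1 / real n) *\<^sub>R (A + (real n - 1) *\<^sub>R D)"

definition point_P :: "nat \<Rightarrow> pt \<Rightarrow> pt \<Rightarrow> pt" where
  "point_P n B D = (1 / real n) *\<^sub>R (2 *\<^sub>R B + (real n - 2) *\<^sub>R D)"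

definition point_N :: "nat \<Rightarrow> pt \<Rightarrow> pt \<Rightarrow> pt" where
  "point_N n B D = (1 / real n) *\<^sub>R (B + (real n - 1) *\<^sub>R D)"

(* labelling n k is the ordered vertex labelling of the tetrahedron with index 2 * k. *)
primrec labelling :: "nat \<Rightarrow> nat \<Rightarrow> pt \<times> pt \<times> pt \<times> pt" where
  "labelling n 0 = initial_labelling n"
| "labelling n (Suc k) =
     (case labelling n k of (A, B, C, D) \<Rightarrow> (point_M n A D, point_N n B D, point_P n B D, C))"

definition T_seq :: "nat \<Rightarrow> nat \<Rightarrow> pt set" where
  "T_seq n k =
     (case labelling n (k div 2) of (A, B, C, D) \<Rightarrow>
        if even k then convex hull {A, B, C, D} else convex hull {point_M n A D, B, C, D})"

end

theory Submission
  imports Defs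
begin

text \<open>
  The mesh consists of a single tetrahedron at the start, and the run is steered: as long as
  the longest edge of the current member \<open>T_seq n k\<close> is not among the longest edges of the
  mesh, any longest edge is cut; as soon as it is, that edge is cut, which creates
  \<open>T_seq n (Suc k)\<close>.  The current member survives until its turn, because every edge that is
  cut earlier is longer than all edges of the current member (\<open>run_invariant\<close>).

  That every member gets its turn, and that the mesh size tends to 0, have the same cause
  (\<open>longest_edges_tend_to_0\<close>), valid for every run of the algorithm and independent of
  the shape of the elements.  If a triangle has longest edge \<open>AB\<close> of length \<open>h\<close>, then
  the distance from the opposite vertex to an interior division point of \<open>AB\<close> is at most
  \<open>c * h\<close> with a constant \<open>c < 1\<close> depending on \<open>n\<close> only.  So each step
  removes one edge of maximal length and creates only edges of length at most \<open>c * h\<close>; the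
  finitely many edges longer than \<open>c * h\<close> are used up, and the maximal length drops by the
  factor \<open>c\<close> again and again.

  Conformity (\<open>subdivide_simplicial_mesh\<close>) is handled on vertex sets: a mesh is conforming if the
  hulls of any two of its vertex sets meet in the hull of the common vertices.  Cutting an edge
  preserves this, since a face of a convex set cuts the hull of finitely many of its points in
  the hull of those points that lie in the face (\<open>hull_Int_face\<close>), and since two pieces of the
  same simplex are separated by the hull of a division point and the vertices off the cut edge.

  The shapes degenerate (\<open>labelling_flat_shape\<close>) for the following reason.  In the tetrahedra
  \<open>T_seq n (2 * k)\<close>, the vertex \<open>A\<close> stands vertically above the corner \<open>B\<close> of a
  horizontal triangle \<open>B C D\<close>, at height \<open>(1 / n) ^ k\<close>.  The horizontal vectors \<open>c = C - B\<close> and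
  \<open>d = D - B\<close> become \<open>- d / n\<close> and \<open>c - (1 - 1 / n) d\<close>, a linear map whose
  characteristic polynomial is \<open>x\<^sup>2 + (1 - 1 / n) x + 1 / n\<close>.  For \<open>n \<le> 5\<close> its roots
  are complex of modulus \<open>1 / sqrt n\<close>, and the initial triangle is chosen such that the map acts
  on it as a similarity of ratio \<open>1 / sqrt n\<close>.  For \<open>n \<ge> 6\<close> the roots are
  \<open>- p\<close> and \<open>- q\<close> with \<open>p * q = 1 / n\<close> and \<open>p < q < 1\<close>, and the initial
  triangle is written in eigencoordinates, so the length of \<open>BD\<close> decreases like \<open>q ^ k\<close>.
  In both cases the ratio of the height to the length of \<open>BD\<close> tends to 0.  The inradius is at
  most the height, the angle \<open>ADB\<close> tends to 0, and the angle \<open>BMD\<close> of the following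
  tetrahedron, whose vertex \<open>M\<close> lies low above an interior point of \<open>BD\<close>, tends to
  \<open>pi\<close>.
\<close>

section \<open>Cutting an edge of a simplex\<close>

lemma division_point_0 [simp]: "division_point n A B 0 = A"
  by (simp add: division_point_def)

lemma division_point_n [simp]: "n > 0 \<Longrightarrow> division_point n A B n = B"
  by (simp add: division_point_def)

lemma division_point_in_segment:
  "j \<le> n \<Longrightarrow> division_point n A B j \<in> closed_segment A B"
  unfolding division_point_def in_segment
  by (rule exI[of _ "real j / real n"]) (auto simp: divide_le_eq_1)

lemma division_point_in_open_segment:
  assumes "A \<noteq> B" "0 < j" "j < n"
  shows "division_point n A B j \<in> open_segment A B"
  unfolding division_point_def in_segment
  using assms by (intro conjI exI[of _ "real j / real n"]) auto

lemma division_point_inject: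
  assumes "A \<noteq> B" "n > 0"
  shows "division_point n A B i = division_point n A B j \<longleftrightarrow> i = j"
proof
  assume "division_point n A B i = division_point n A B j"
  then have "(real i / n - real j / n) *\<^sub>R (A - B) = 0"
    by (simp add: division_point_def algebra_simps)
  then show "i = j" using assms by (auto simp: divide_simps)
qed auto

lemma division_point_between:
  assumes "i \<le> j" "j \<le> k" "n > 0"
  shows "division_point n A B j \<in> closed_segment (division_point n A B i) (division_point n A B k)"
proof (cases "i = k")
  case True then show ?thesis using assms by auto
next
  case False
  define s where "s = (real j - real i) / (real k - real i)"
  have s: "0 \<le> s" "s \<le> 1" and sj: "(real k - real i) * s = real j - real i"
    using assms False by (auto simp: s_def divide_simps)
  have e: "real j / n = (1 - s) * (real i / n) + s * (real k / n)"
  proof -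
    have "real j = (1 - s) * real i + s * real k" using sj by (simp add: algebra_simps)
    then show ?thesis by (simp add: add_divide_distrib)
  qed
  have "division_point n A B j
      = (1 - s) *\<^sub>R division_point n A B i + s *\<^sub>R division_point n A B k"
    unfolding division_point_def e by (simp add: algebra_simps)
  then show ?thesis using s by (auto simp: in_segment)
qed

lemma segment_covered_by_sections:
  assumes "x \<in> closed_segment A B" "n > 0"
  obtains j where "1 \<le> j" "j \<le> n"
    "x \<in> closed_segment (division_point n A B (j - 1)) (division_point n A B j)"
proof -
  obtain t where t: "0 \<le> t" "t \<le> 1" and x: "x = (1 - t) *\<^sub>R A + t *\<^sub>R B"
    using assms by (auto simp: in_segment)
  \<comment> \<open>the maximum only matters for \<open>t = 0\<close>, the left end of the first section\<close>
  define j where "j = max 1 (nat \<lceil>t * n\<rceil>)"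
  have tn: "t * n \<le> n" "0 \<le> t * n" using t assms by (auto simp: mult_left_le_one_le)
  have j1: "1 \<le> j" by (simp add: j_def)
  have jn: "j \<le> n" using assms tn by (simp add: j_def nat_le_iff ceiling_le_iff)
  define s where "s = t * n - (real j - 1)"
  have s: "0 \<le> s" "s \<le> 1"
    using tn unfolding s_def j_def by (auto simp: max_def; linarith)+
  have e: "t = (1 - s) * (real (j - 1) / n) + s * (real j / n)"
    using assms(2) j1 by (simp add: s_def field_simps of_nat_diff)
  have "x = (1 - s) *\<^sub>R division_point n A B (j - 1) + s *\<^sub>R division_point n A B j"
    unfolding x division_point_def by (subst (1 2) e) (simp add: algebra_simps)
  then show ?thesis using that[OF j1 jn] s by (auto simp: in_segment)
qed

text \<open>
  The pieces of an edge section, described by their vertex sets; \<open>V\<close> may be any set of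
  points, so that the same notation serves for the faces of a simplex.
\<close>
definition child :: "nat \<Rightarrow> pt \<Rightarrow> pt \<Rightarrow> nat \<Rightarrow> pt set \<Rightarrow> pt set" where
  "child n A B j V = {division_point n A B (j - 1), division_point n A B j} \<union> (V - {A, B})"

lemma child_mono: "F \<subseteq> V \<Longrightarrow> child n A B j F \<subseteq> child n A B j V"
  by (auto simp: child_def)

lemma child_in_hull:
  assumes "A \<in> V" "B \<in> V" "j \<le> n"
  shows "child n A B j V \<subseteq> convex hull V"
proof -
  have "closed_segment A B \<subseteq> convex hull V"
    unfolding segment_convex_hull by (rule hull_mono) (use assms in auto)
  then show ?thesis
    using assms division_point_in_segment[of j n A B] division_point_in_segment[of "j - 1" n A B]
    unfolding child_def by (auto intro: hull_inc)
qed

lemma child_hull_subset: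
  "A \<in> V \<Longrightarrow> B \<in> V \<Longrightarrow> j \<le> n \<Longrightarrow> convex hull (child n A B j V) \<subseteq> convex hull V"
  using child_in_hull by (intro hull_minimal) auto

text \<open>
  The new points span the same line as the edge that they replace, so the affine hull does not
  change; a set that has no more points than an independent set with the same affine hull is
  itself independent.
\<close>
lemma replace_edge_in_independent_set:
  fixes V :: "'a::euclidean_space set"
  assumes V: "\<not> affine_dependent V" and AB: "A \<in> V" "B \<in> V" "A \<noteq> B"
    and PQ: "P \<in> affine hull {A, B}" "Q \<in> affine hull {A, B}" "P \<noteq> Q"
  defines "W \<equiv> {P, Q} \<union> (V - {A, B})"
  shows "\<not> affine_dependent W" "card W = card V"
proof -
  have fin: "finite V" using V by (rule aff_independent_finite)
  have "affine hull {P, Q} = affine hull {A, B}"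
  proof (rule affine_dim_equal)
    show "affine hull {P, Q} \<subseteq> affine hull {A, B}"
      by (rule hull_minimal) (use PQ in auto)
    have "aff_dim {P, Q} = 1" "aff_dim {A, B} = 1" using PQ AB by (simp_all add: aff_dim_2)
    then show "aff_dim (affine hull {P, Q}) = aff_dim (affine hull {A, B})" by simp
  qed auto
  then have "{A, B} \<subseteq> affine hull {P, Q}" by (metis hull_subset)
  then have "{A, B} \<subseteq> affine hull W"
    unfolding W_def using hull_mono[of "{P, Q}" "{P, Q} \<union> (V - {A, B})" affine] by blast
  then have "V \<subseteq> affine hull W" unfolding W_def by (auto intro: hull_inc)
  then have "aff_dim V \<le> aff_dim W" using aff_dim_subset aff_dim_affine_hull by metis
  moreover have "aff_dim V = int (card V) - 1" using V by (simp add: affine_independent_iff_card)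
  moreover have "aff_dim W \<le> int (card W) - 1" by (rule aff_dim_le_card) (simp add: W_def fin)
  moreover have "card W \<le> card V"
  proof -
    have "card W \<le> card {P, Q} + card (V - {A, B})" unfolding W_def by (rule card_Un_le)
    also have "\<dots> = 2 + (card V - 2)" using AB PQ fin by (simp add: card_Diff_subset)
    also have "\<dots> = card V" using card_mono[OF fin, of "{A, B}"] AB by simp
    finally show ?thesis .
  qed
  ultimately show "card W = card V" "\<not> affine_dependent W"
    by (auto simp: affine_independent_iff_card W_def fin)
qed

lemma division_point_in_affine_hull:
  "division_point n A B j \<in> affine hull {A, B}"
  unfolding affine_hull_2 mem_Collect_eq
  by (rule exI[of _ "1 - real j / real n"], rule exI[of _ "real j / real n"])
    (simp add: division_point_def)

lemma child_independent:
  assumes "\<not> affine_dependent V" "A \<in> V" "B \<in> V" "A \<noteq> B" "1 \<le> j" "n > 0"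
  shows "\<not> affine_dependent (child n A B j V)" "card (child n A B j V) = card V"
  unfolding child_def using assms
  by (intro replace_edge_in_independent_set; simp add: division_point_in_affine_hull division_point_inject)+

text \<open>
  A face of \<open>T\<close> cuts the convex hull of points of \<open>T\<close> in one of the faces of that hull,
  and a face of the hull of a finite set is the hull of some of its points.
\<close>
lemma hull_Int_face:
  fixes S :: "'a::euclidean_space set"
  assumes "F face_of T" "convex T" "finite S" "S \<subseteq> T"
  shows "convex hull S \<inter> F = convex hull (S \<inter> F)"
proof
  have sub: "convex hull S \<subseteq> T" using assms by (simp add: hull_minimal)
  have "(F \<inter> convex hull S) face_of (T \<inter> convex hull S)"
    by (rule face_of_slice) (use assms in auto)
  then have "(convex hull S \<inter> F) face_of (convex hull S)"
    using sub by (simp add: Int_commute Int_absorb1)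
  then obtain S' where S': "S' \<subseteq> S" "convex hull S \<inter> F = convex hull S'"
    using face_of_convex_hull_subset[OF finite_imp_compact[OF assms(3)]] by metis
  then have "S' \<subseteq> S \<inter> F" using hull_subset[of S' convex] by auto
  then show "convex hull S \<inter> F \<subseteq> convex hull (S \<inter> F)" using S' by (metis hull_mono)
  show "convex hull (S \<inter> F) \<subseteq> convex hull S \<inter> F"
    using face_of_imp_convex[OF assms(1)] by (simp add: hull_mono hull_minimal)
qed

lemma hull_subset_face:
  fixes V :: "'a::euclidean_space set"
  shows "\<not> affine_dependent V \<Longrightarrow> F \<subseteq> V \<Longrightarrow> convex hull F face_of convex hull V"
  by (auto simp: face_of_convex_hull_affine_independent)

lemma vertex_in_hull_subset:
  fixes V :: "'a::euclidean_space set"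
  assumes "\<not> affine_dependent V" "F \<subseteq> V" "v \<in> V" "v \<in> convex hull F"
  shows "v \<in> F"
  using assms
  by (metis extreme_point_of_convex_hull extreme_point_of_convex_hull_affine_independent
      extreme_point_of_face hull_subset_face)

text \<open>
  A piece of a simplex meets a face of the simplex in the corresponding piece of the face if
  the face contains the cut edge, and otherwise in a common face.  The reason in the second case:
  a face that contains an interior division point of an edge contains both ends of the edge.
\<close>
lemma child_hull_Int_face:
  assumes V: "\<not> affine_dependent V" and AB: "A \<in> V" "B \<in> V" "A \<noteq> B"
    and F: "F \<subseteq> V" and j: "1 \<le> j" "j \<le> n"
  shows "convex hull (child n A B j V) \<inter> convex hull F
    \<subseteq> convex hull (if {A, B} \<subseteq> F then child n A B j F else child n A B j V \<inter> F)"
proof -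
  have face: "convex hull F face_of convex hull V" using V F by (rule hull_subset_face)
  have fin: "finite (child n A B j V)" using aff_independent_finite[OF V] by (simp add: child_def)
  have *: "convex hull (child n A B j V) \<inter> convex hull F
      = convex hull (child n A B j V \<inter> convex hull F)"
    by (rule hull_Int_face[OF face convex_convex_hull fin]) (use child_in_hull AB j in blast)
  have vert: "v \<in> F" if "v \<in> V" "v \<in> convex hull F" for v
    using vertex_in_hull_subset[OF V F] that by blast
  have dp: "division_point n A B i \<in> F" if "i \<le> n" "division_point n A B i \<in> convex hull F"
      "\<not> {A, B} \<subseteq> F" for i
  proof (cases "i = 0 \<or> i = n")
    case True
    then show ?thesis using that vert AB j by auto
  next
    case False
    then have "division_point n A B i \<in> open_segment A B"
      using that AB by (intro division_point_in_open_segment) auto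
    then have "A \<in> convex hull F \<and> B \<in> convex hull F"
      using face_ofD[OF face _ _ _ that(2)] AB by (blast intro: hull_inc)
    then show ?thesis using vert AB that by auto
  qed
  have "child n A B j V \<inter> convex hull F
     \<subseteq> (if {A, B} \<subseteq> F then child n A B j F else child n A B j V \<inter> F)"
    using vert dp[of j] dp[of "j - 1"] j unfolding child_def by auto
  then show ?thesis unfolding * by (rule hull_mono)
qed

text \<open>
  The cut through the division point \<open>k\<close> separates the pieces on its two sides: one side lies
  in the hull of the division point and all vertices but \<open>B\<close>, the other in the hull of the division
  point and all vertices but \<open>A\<close>.
\<close>
lemma sibling_hulls_Int_subset_cut:
  assumes V: "\<not> affine_dependent V" and AB: "A \<in> V" "B \<in> V" "A \<noteq> B"
    and ij: "1 \<le> i" "i \<le> k" "k < j" "j \<le> n"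
  shows "convex hull (child n A B i V) \<inter> convex hull (child n A B j V)
    \<subseteq> convex hull (insert (division_point n A B k) (V - {A, B}))"
proof -
  let ?P = "division_point n A B"
  have seg: "?P l \<in> convex hull (insert (?P k) (V - {B}))" if "l \<le> k" for l
  proof -
    have "?P l \<in> closed_segment (?P 0) (?P k)" using that ij by (intro division_point_between) auto
    also have "\<dots> \<subseteq> convex hull (insert (?P k) (V - {B}))"
      unfolding segment_convex_hull by (rule hull_mono) (use AB in auto)
    finally show ?thesis .
  qed
  have seg': "?P l \<in> convex hull (insert (?P k) (V - {A}))" if "k \<le> l" "l \<le> n" for l
  proof -
    have "?P l \<in> closed_segment (?P k) (?P n)" using that ij by (intro division_point_between) auto
    also have "\<dots> \<subseteq> convex hull (insert (?P k) (V - {A}))"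
      unfolding segment_convex_hull by (rule hull_mono) (use AB ij in auto)
    finally show ?thesis .
  qed
  have "convex hull (child n A B i V) \<subseteq> convex hull (insert (?P k) (V - {B}))"
    by (rule hull_minimal) (use seg[of i] seg[of "i - 1"] ij in \<open>auto simp: child_def intro: hull_inc\<close>)
  moreover have "convex hull (child n A B j V) \<subseteq> convex hull (insert (?P k) (V - {A}))"
    by (rule hull_minimal) (use seg'[of j] seg'[of "j - 1"] ij in \<open>auto simp: child_def intro: hull_inc\<close>)
  moreover have "?P k \<in> convex hull V"
    using child_in_hull[of A V B k n] AB ij by (auto simp: child_def)
  ultimately have "convex hull (child n A B i V) \<inter> convex hull (child n A B j V)
     \<subseteq> convex hull (insert (?P k) ((V - {B}) \<inter> (V - {A})))"
    using convex_hull_exchange_Int[OF V, of "?P k" "V - {B}" "V - {A}"] by blast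
  also have "(V - {B}) \<inter> (V - {A}) = V - {A, B}" by auto
  finally show ?thesis .
qed

text \<open>
  Neighbouring pieces meet in the cut between them.  Pieces further apart are separated by two
  different cuts, which have only the face opposite to the edge in common.
\<close>
lemma sibling_hulls_Int:
  assumes V: "\<not> affine_dependent V" and AB: "A \<in> V" "B \<in> V" "A \<noteq> B"
    and ij: "1 \<le> i" "i \<le> n" "1 \<le> j" "j \<le> n"
  shows "convex hull (child n A B i V) \<inter> convex hull (child n A B j V)
    \<subseteq> convex hull (child n A B i V \<inter> child n A B j V)"
  using ij
proof (induction i j rule: linorder_wlog)
  case (sym i j) then show ?case by (simp add: Int_commute)
next
  case (le i j)
  let ?P = "division_point n A B" and ?R = "V - {A, B}"
  let ?I = "convex hull (child n A B i V) \<inter> convex hull (child n A B j V)"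
  consider "i = j" | "j = Suc i" | "i < j - 1" using le by linarith
  then show ?case
  proof cases
    case 1 then show ?thesis by simp
  next
    case 2
    have "?I \<subseteq> convex hull (insert (?P i) ?R)"
      by (rule sibling_hulls_Int_subset_cut[OF V AB]) (use le 2 in auto)
    also have "\<dots> \<subseteq> convex hull (child n A B i V \<inter> child n A B j V)"
      by (rule hull_mono) (use 2 in \<open>auto simp: child_def\<close>)
    finally show ?thesis .
  next
    case 3
    have "?I \<subseteq> convex hull (insert (?P i) ?R)" "?I \<subseteq> convex hull (insert (?P (j - 1)) ?R)"
      by (rule sibling_hulls_Int_subset_cut[OF V AB]; use le 3 in auto)+
    moreover have ne: "?P i \<noteq> ?P (j - 1)" using 3 AB le by (simp add: division_point_inject)
    have W: "\<not> affine_dependent ({?P i, ?P (j - 1)} \<union> ?R)"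
      "card ({?P i, ?P (j - 1)} \<union> ?R) = card V"
      using replace_edge_in_independent_set[OF V AB division_point_in_affine_hull
          division_point_in_affine_hull ne] by blast+
    have fin: "finite V" using V by (rule aff_independent_finite)
    have "?P i \<notin> ?R"
    proof
      assume "?P i \<in> ?R"
      then have "{?P i, ?P (j - 1)} \<union> ?R = insert (?P (j - 1)) ?R" by auto
      then have "card V \<le> Suc (card ?R)" using W(2) fin
        by (simp add: card_insert_if split: if_splits)
      moreover have "card ?R = card V - 2" using AB fin by (simp add: card_Diff_subset)
      moreover have "card V \<ge> 2" using card_mono[OF fin, of "{A, B}"] AB by simp
      ultimately show False by simp
    qed
    then have "insert (?P i) ?R \<inter> insert (?P (j - 1)) ?R = ?R" using ne by auto
    moreover have "insert (?P i) ?R \<union> insert (?P (j - 1)) ?R = {?P i, ?P (j - 1)} \<union> ?R" by auto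
    ultimately have "?I \<subseteq> convex hull ?R"
      using convex_hull_Int[of "insert (?P i) ?R" "insert (?P (j - 1)) ?R"] W(1) by (simp add: le_inf_iff)
    also have "\<dots> \<subseteq> convex hull (child n A B i V \<inter> child n A B j V)"
      by (rule hull_mono) (auto simp: child_def)
    finally show ?thesis .
  qed
qed

text \<open>
  A point of the simplex lies on a segment from a point of the edge to a point of the opposite
  face, and the point of the edge belongs to one of the \<open>n\<close> sections.
\<close>
lemma hull_covered_by_children:
  assumes AB: "A \<in> V" "B \<in> V" and R: "V - {A, B} \<noteq> {}" and "n > 0"
  shows "convex hull V = (\<Union>j\<in>{1..n}. convex hull (child n A B j V))"
proof
  show "(\<Union>j\<in>{1..n}. convex hull (child n A B j V)) \<subseteq> convex hull V"
    using child_in_hull[OF AB] by (intro UN_least hull_minimal) auto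
  let ?R = "V - {A, B}"
  have "V = {A, B} \<union> ?R" using AB by auto
  then have "convex hull V = convex hull (closed_segment A B \<union> convex hull ?R)"
    unfolding segment_convex_hull using hull_Un_left hull_Un_right by metis
  also have "\<dots> = {u *\<^sub>R s + v *\<^sub>R t | u v s t.
      u \<ge> 0 \<and> v \<ge> 0 \<and> u + v = 1 \<and> s \<in> closed_segment A B \<and> t \<in> convex hull ?R}"
    by (rule convex_hull_union_two) (use R in auto)
  also have "\<dots> \<subseteq> (\<Union>j\<in>{1..n}. convex hull (child n A B j V))"
  proof safe
    fix u v :: real and s t
    assume uv: "0 \<le> u" "0 \<le> v" "u + v = 1" and s: "s \<in> closed_segment A B"
      and t: "t \<in> convex hull ?R"
    obtain j where j: "1 \<le> j" "j \<le> n"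
      and sj: "s \<in> closed_segment (division_point n A B (j - 1)) (division_point n A B j)"
      using segment_covered_by_sections[OF s \<open>n > 0\<close>] .
    have "closed_segment (division_point n A B (j - 1)) (division_point n A B j)
        \<subseteq> convex hull (child n A B j V)"
      unfolding segment_convex_hull child_def by (rule hull_mono) auto
    moreover have "convex hull ?R \<subseteq> convex hull (child n A B j V)"
      by (rule hull_mono) (auto simp: child_def)
    ultimately have "s \<in> convex hull (child n A B j V)" "t \<in> convex hull (child n A B j V)"
      using sj t by auto
    then have "u *\<^sub>R s + v *\<^sub>R t \<in> convex hull (child n A B j V)"
      using uv by (intro convexD convex_convex_hull)
    then show "u *\<^sub>R s + v *\<^sub>R t \<in> (\<Union>j\<in>{1..n}. convex hull (child n A B j V))" using j by auto
  qed
  finally show "convex hull V \<subseteq> (\<Union>j\<in>{1..n}. convex hull (child n A B j V))" .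
qed

section \<open>Simplicial meshes and the longest-edge step\<close>

text \<open>
  A conforming tetrahedral mesh of the region \<open>S\<close>, as a set of vertex sets.  The condition on
  intersections is the face-to-face property.
\<close>
definition simplicial_mesh :: "pt set \<Rightarrow> pt set set \<Rightarrow> bool" where
  "simplicial_mesh S K \<longleftrightarrow>
     finite K \<and> (\<forall>V\<in>K. \<not> affine_dependent V \<and> card V = 4) \<and>
     (\<forall>V\<in>K. \<forall>W\<in>K. convex hull V \<inter> convex hull W \<subseteq> convex hull (V \<inter> W)) \<and>
     (\<Union>V\<in>K. convex hull V) = S"

definition subdivide :: "nat \<Rightarrow> pt \<Rightarrow> pt \<Rightarrow> pt set set \<Rightarrow> pt set set" where
  "subdivide n A B K =
     {V\<in>K. \<not> {A, B} \<subseteq> V} \<union> {child n A B j V | V j. V \<in> K \<and> {A, B} \<subseteq> V \<and> 1 \<le> j \<and> j \<le> n}"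

lemma subdivide_cases:
  assumes "X \<in> subdivide n A B K"
  obtains "X \<in> K" "\<not> {A, B} \<subseteq> X"
  | V j where "V \<in> K" "A \<in> V" "B \<in> V" "1 \<le> j" "j \<le> n" "X = child n A B j V"
  using assms by (auto simp: subdivide_def)

lemma finite_subdivide: "finite K \<Longrightarrow> finite (subdivide n A B K)"
proof -
  assume "finite K"
  moreover have "subdivide n A B K \<subseteq> K \<union> (\<lambda>(V, j). child n A B j V) ` (K \<times> {1..n})"
    by (auto simp: subdivide_def)
  ultimately show ?thesis by (meson finite_UnI finite_SigmaI finite_atLeastAtMost finite_imageI finite_subset)
qed

text \<open>
  A piece of a cut element against an element that is not cut: their intersection lies in the
  common face of the two elements, which does not contain the cut edge.
\<close>
lemma child_hull_Int_unsplit_hull: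
  assumes V: "\<not> affine_dependent V" "A \<in> V" "B \<in> V" "A \<noteq> B"
    and j: "1 \<le> j" "j \<le> n"
    and W: "\<not> {A, B} \<subseteq> W"
    and VW: "convex hull V \<inter> convex hull W \<subseteq> convex hull (V \<inter> W)"
  shows "convex hull (child n A B j V) \<inter> convex hull W \<subseteq> convex hull (child n A B j V \<inter> W)"
proof -
  have "convex hull (child n A B j V) \<subseteq> convex hull V"
    using V j by (intro child_hull_subset) auto
  then have "convex hull (child n A B j V) \<inter> convex hull W
      \<subseteq> convex hull (child n A B j V) \<inter> convex hull (V \<inter> W)" using VW by blast
  also have "\<dots> \<subseteq> convex hull (child n A B j V \<inter> (V \<inter> W))"
    using child_hull_Int_face[OF V, of "V \<inter> W" j n] j W by auto
  also have "\<dots> \<subseteq> convex hull (child n A B j V \<inter> W)" by (rule hull_mono) auto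
  finally show ?thesis .
qed

text \<open>
  Pieces of two cut elements: everything happens in the common face \<open>V \<inter> W\<close>, on which the
  two cuts agree because they use the same division points.
\<close>
lemma children_hulls_Int:
  assumes V: "\<not> affine_dependent V" "A \<in> V" "B \<in> V"
    and W: "\<not> affine_dependent W" "A \<in> W" "B \<in> W" and AB: "A \<noteq> B"
    and i: "1 \<le> i" "i \<le> n" and j: "1 \<le> j" "j \<le> n"
    and VW: "convex hull V \<inter> convex hull W \<subseteq> convex hull (V \<inter> W)"
  shows "convex hull (child n A B i V) \<inter> convex hull (child n A B j W)
    \<subseteq> convex hull (child n A B i V \<inter> child n A B j W)"
proof -
  let ?F = "V \<inter> W"
  have F: "\<not> affine_dependent ?F" using V affine_independent_subset by blast
  have "convex hull (child n A B i V) \<subseteq> convex hull V" "convex hull (child n A B j W) \<subseteq> convex hull W"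
    using V W i j by (intro child_hull_subset; simp)+
  then have "convex hull (child n A B i V) \<inter> convex hull (child n A B j W)
      \<subseteq> (convex hull (child n A B i V) \<inter> convex hull ?F) \<inter>
        (convex hull (child n A B j W) \<inter> convex hull ?F)" using VW by blast
  also have "\<dots> \<subseteq> convex hull (child n A B i ?F) \<inter> convex hull (child n A B j ?F)"
    using child_hull_Int_face[OF V AB, of ?F i n] child_hull_Int_face[OF W AB, of ?F j n] V W i j
    by (intro Int_mono) auto
  also have "\<dots> \<subseteq> convex hull (child n A B i ?F \<inter> child n A B j ?F)"
    using sibling_hulls_Int[OF F] V W AB i j by auto
  also have "\<dots> \<subseteq> convex hull (child n A B i V \<inter> child n A B j W)"
    by (intro hull_mono Int_mono child_mono) auto
  finally show ?thesis .
qed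

lemma subdivide_simplicial_mesh:
  assumes K: "simplicial_mesh S K" and AB: "A \<noteq> B" and n: "n > 0"
  shows "simplicial_mesh S (subdivide n A B K)"
proof -
  let ?K = "subdivide n A B K"
  have ind: "\<not> affine_dependent V" "card V = 4" if "V \<in> K" for V
    using K that by (auto simp: simplicial_mesh_def)
  have Int: "convex hull V \<inter> convex hull W \<subseteq> convex hull (V \<inter> W)" if "V \<in> K" "W \<in> K" for V W
    using K that by (auto simp: simplicial_mesh_def)
  have "finite ?K" using K by (simp add: simplicial_mesh_def finite_subdivide)
  moreover have "\<not> affine_dependent X \<and> card X = 4" if "X \<in> ?K" for X
    using that ind child_independent[OF ind(1) _ _ AB _ n] by (cases rule: subdivide_cases) auto
  moreover have "convex hull X \<inter> convex hull Y \<subseteq> convex hull (X \<inter> Y)"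
    if X: "X \<in> ?K" and Y: "Y \<in> ?K" for X Y
    using X
  proof (cases rule: subdivide_cases)
    case 1
    note X = this
    from Y show ?thesis
    proof (cases rule: subdivide_cases)
      case 1 then show ?thesis using X Int by blast
    next
      case (2 W j)
      then show ?thesis
        using child_hull_Int_unsplit_hull[OF ind(1) _ _ AB _ _ X(2) Int, of W j n] X by (simp add: Int_commute)
    qed
  next
    case (2 V i)
    note X = this
    from Y show ?thesis
    proof (cases rule: subdivide_cases)
      case 1
      then show ?thesis
        using child_hull_Int_unsplit_hull[OF ind(1) _ _ AB _ _ 1(2) Int, of V i n] X by simp
    next
      case (2 W j)
      then show ?thesis
        using children_hulls_Int[OF ind(1) _ _ ind(1) _ _ AB _ _ _ _ Int] X by simp
    qed
  qed
  moreover have "(\<Union>V\<in>?K. convex hull V) = S"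
  proof -
    have cov: "convex hull V = (\<Union>j\<in>{1..n}. convex hull (child n A B j V))"
      if "V \<in> K" "A \<in> V" "B \<in> V" for V
    proof (rule hull_covered_by_children)
      show "V - {A, B} \<noteq> {}"
      proof
        assume "V - {A, B} = {}"
        then have "card V \<le> card {A, B}" by (intro card_mono) auto
        then show False using ind[OF that(1)] AB by simp
      qed
    qed (use that n in auto)
    have "(\<Union>V\<in>?K. convex hull V) = (\<Union>V\<in>{V\<in>K. \<not> {A, B} \<subseteq> V}. convex hull V) \<union>
        (\<Union>V\<in>{V\<in>K. {A, B} \<subseteq> V}. \<Union>j\<in>{1..n}. convex hull (child n A B j V))"
      unfolding subdivide_def by fastforce
    also have "\<dots> = (\<Union>V\<in>{V\<in>K. \<not> {A, B} \<subseteq> V}. convex hull V) \<union>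
        (\<Union>V\<in>{V\<in>K. {A, B} \<subseteq> V}. convex hull V)" using cov by simp
    also have "\<dots> = (\<Union>V\<in>K. convex hull V)" by auto
    also have "\<dots> = S" using K by (simp add: simplicial_mesh_def)
    finally show ?thesis .
  qed
  ultimately show ?thesis by (simp add: simplicial_mesh_def)
qed

definition tets :: "pt set set \<Rightarrow> pt set set" where
  "tets K = (\<lambda>V. convex hull V) ` K"

lemma vertices_hull: "\<not> affine_dependent V \<Longrightarrow> vertices (convex hull V) = V"
  by (auto simp: vertices_def extreme_point_of_convex_hull_affine_independent)

lemma is_edge_hull:
  assumes "\<not> affine_dependent V"
  shows "is_edge A B (convex hull V) \<longleftrightarrow> A \<in> V \<and> B \<in> V \<and> A \<noteq> B"
proof
  assume "is_edge A B (convex hull V)"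
  then have f: "closed_segment A B face_of convex hull V" and d: "aff_dim (closed_segment A B) = 1"
    by (auto simp: is_edge_def edge_of_def)
  have "A extreme_point_of closed_segment A B" "B extreme_point_of closed_segment A B"
    by (auto simp: extreme_point_of_segment)
  then have "A \<in> V" "B \<in> V"
    using f assms by (auto simp: extreme_point_of_face extreme_point_of_convex_hull_affine_independent)
  moreover have "A \<noteq> B" using d by auto
  ultimately show "A \<in> V \<and> B \<in> V \<and> A \<noteq> B" by blast
next
  assume *: "A \<in> V \<and> B \<in> V \<and> A \<noteq> B"
  then have "convex hull {A, B} face_of convex hull V" using assms by (intro hull_subset_face) auto
  moreover have "aff_dim (convex hull {A, B}) = 1" using * by (simp add: aff_dim_convex_hull aff_dim_2)
  ultimately show "is_edge A B (convex hull V)"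
    by (simp add: is_edge_def edge_of_def segment_convex_hull)
qed

text \<open>
  Two different elements share at most three vertices, so the common face has dimension at most
  two; in particular its interior is empty.
\<close>
lemma simplicial_mesh_partition:
  assumes "simplicial_mesh S K" and S: "S = closure \<Omega>"
  shows "tetrahedral_partition \<Omega> (tets K)" "conforming (tets K)"
proof -
  have fin: "finite K" and ind: "\<And>V. V \<in> K \<Longrightarrow> \<not> affine_dependent V" "\<And>V. V \<in> K \<Longrightarrow> card V = 4"
    and un: "(\<Union>V\<in>K. convex hull V) = S"
    and sub: "\<And>V W. V \<in> K \<Longrightarrow> W \<in> K \<Longrightarrow> convex hull V \<inter> convex hull W \<subseteq> convex hull (V \<inter> W)"
    using assms by (auto simp: simplicial_mesh_def)
  have Int: "convex hull V \<inter> convex hull W = convex hull (V \<inter> W)" if "V \<in> K" "W \<in> K" for V W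
    using sub[OF that] by (intro subset_antisym Int_greatest) (auto intro: hull_mono[THEN subsetD])
  have finV: "finite V" if "V \<in> K" for V using ind(1)[OF that] by (rule aff_independent_finite)
  have dim: "aff_dim (convex hull (V \<inter> W)) = int (card (V \<inter> W)) - 1" "card (V \<inter> W) < 4"
    if "V \<in> K" "W \<in> K" "V \<noteq> W" for V W
  proof -
    have "\<not> affine_dependent (V \<inter> W)" using ind that affine_independent_subset by blast
    then show "aff_dim (convex hull (V \<inter> W)) = int (card (V \<inter> W)) - 1"
      by (simp add: affine_independent_iff_card aff_dim_convex_hull)
    have "V \<inter> W \<noteq> V"
      using that ind card_subset_eq[OF finV[OF that(2)], of V] by auto
    then have "V \<inter> W \<subset> V" by blast
    then show "card (V \<inter> W) < 4"
      using psubset_card_mono[OF finV[OF that(1)]] ind(2)[OF that(1)] by simp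
  qed
  show "tetrahedral_partition \<Omega> (tets K)"
    unfolding tetrahedral_partition_def
  proof (intro conjI ballI impI)
    show "finite (tets K)" using fin by (simp add: tets_def)
    show "tetrahedron T" if "T \<in> tets K" for T
      using that ind by (auto simp: tets_def intro!: simplex_convex_hull)
    show "\<Union> (tets K) = closure \<Omega>" using un S by (simp add: tets_def)
    fix X Y assume "X \<in> tets K" "Y \<in> tets K" "X \<noteq> Y"
    then obtain V W where VW: "V \<in> K" "W \<in> K" "V \<noteq> W" "X = convex hull V" "Y = convex hull W"
      by (auto simp: tets_def)
    have "interior (X \<inter> Y) = {}"
      using dim[OF VW(1-3)] aff_dim_nonempty_interior[of "X \<inter> Y"] VW Int by auto
    then show "interior X \<inter> interior Y = {}" by (simp add: interior_Int)
  qed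
  show "conforming (tets K)"
    unfolding conforming_def
  proof (intro ballI impI)
    fix X Y assume "X \<in> tets K" "Y \<in> tets K" "X \<noteq> Y"
    then obtain V W where VW: "V \<in> K" "W \<in> K" "V \<noteq> W" "X = convex hull V" "Y = convex hull W"
      by (auto simp: tets_def)
    have XY: "X \<inter> Y = convex hull (V \<inter> W)" using VW Int by simp
    have "(X \<inter> Y) face_of X" "(X \<inter> Y) face_of Y"
      unfolding XY unfolding VW(4,5) using ind VW by (simp_all add: hull_subset_face)
    moreover have "aff_dim (X \<inter> Y) \<in> {0, 1, 2}" if "X \<inter> Y \<noteq> {}"
    proof -
      have "V \<inter> W \<noteq> {}" using that XY by auto
      then have "card (V \<inter> W) \<noteq> 0" using finV VW by simp
      then show ?thesis using dim[OF VW(1-3)] unfolding XY by auto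
    qed
    ultimately show "X \<inter> Y = {} \<or> X \<inter> Y face_of X \<and> X \<inter> Y face_of Y \<and> aff_dim (X \<inter> Y) \<in> {0, 1, 2}"
      by blast
  qed
qed

definition mesh_edges :: "pt set set \<Rightarrow> (pt \<times> pt) set" where
  "mesh_edges K = (\<Union>V\<in>K. {(a, b). a \<in> V \<and> b \<in> V \<and> a \<noteq> b})"

lemma mesh_edgesI: "V \<in> K \<Longrightarrow> a \<in> V \<Longrightarrow> b \<in> V \<Longrightarrow> a \<noteq> b \<Longrightarrow> (a, b) \<in> mesh_edges K"
  by (auto simp: mesh_edges_def)

definition longest_edge :: "pt \<Rightarrow> pt \<Rightarrow> pt set set \<Rightarrow> bool" where
  "longest_edge A B K \<longleftrightarrow>
     (A, B) \<in> mesh_edges K \<and> (\<forall>(a, b)\<in>mesh_edges K. dist a b \<le> dist A B)"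

lemma longest_mesh_edge_tets:
  assumes "simplicial_mesh S K" "longest_edge A B K"
  shows "longest_mesh_edge A B (tets K)"
proof -
  have "is_edge a b (convex hull V) \<longleftrightarrow> a \<in> V \<and> b \<in> V \<and> a \<noteq> b" if "V \<in> K" for a b V
    using assms(1) that by (intro is_edge_hull) (simp add: simplicial_mesh_def)
  then show ?thesis
    using assms(2) unfolding longest_mesh_edge_def longest_edge_def mesh_edges_def tets_def by auto
qed

lemma tets_subdivide:
  assumes K: "simplicial_mesh S K" and "A \<noteq> B"
  shows "tets (subdivide n A B K) = (tets K - edge_star A B (tets K)) \<union>
    (\<Union>T\<in>edge_star A B (tets K). edge_section n T A B)"
proof -
  have ind: "\<And>V. V \<in> K \<Longrightarrow> \<not> affine_dependent V" using K by (auto simp: simplicial_mesh_def)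
  have edge: "is_edge A B (convex hull V) \<longleftrightarrow> {A, B} \<subseteq> V" if "V \<in> K" for V
    using is_edge_hull[OF ind[OF that]] assms(2) by simp
  have st: "edge_star A B (tets K) = (\<lambda>V. convex hull V) ` {V \<in> K. {A, B} \<subseteq> V}"
    using edge unfolding tets_def edge_star_def by blast
  have "tets K - edge_star A B (tets K) = (\<lambda>V. convex hull V) ` {V \<in> K. \<not> {A, B} \<subseteq> V}"
  proof -
    have "tets K - edge_star A B (tets K) = {T \<in> tets K. \<not> is_edge A B T}"
      by (auto simp: edge_star_def)
    also have "\<dots> = (\<lambda>V. convex hull V) ` {V \<in> K. \<not> is_edge A B (convex hull V)}"
      by (auto simp: tets_def)
    also have "{V \<in> K. \<not> is_edge A B (convex hull V)} = {V \<in> K. \<not> {A, B} \<subseteq> V}"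
      using edge by blast
    finally show ?thesis .
  qed
  moreover have "edge_section n (convex hull V) A B = {convex hull (child n A B j V) | j. 1 \<le> j \<and> j \<le> n}"
    if "V \<in> K" for V
    using ind that by (simp add: edge_section_def child_def vertices_hull)
  then have "(\<Union>T\<in>edge_star A B (tets K). edge_section n T A B) =
      (\<Union>V\<in>{V \<in> K. {A, B} \<subseteq> V}. {convex hull (child n A B j V) | j. 1 \<le> j \<and> j \<le> n})"
    unfolding st by simp
  moreover have "(\<lambda>V. convex hull V) ` {child n A B j V | V j. V \<in> K \<and> {A, B} \<subseteq> V \<and> 1 \<le> j \<and> j \<le> n}
      = (\<Union>V\<in>{V \<in> K. {A, B} \<subseteq> V}. {convex hull (child n A B j V) | j. 1 \<le> j \<and> j \<le> n})"
    by blast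
  moreover have "tets (subdivide n A B K) = (\<lambda>V. convex hull V) ` {V \<in> K. \<not> {A, B} \<subseteq> V} \<union>
      (\<lambda>V. convex hull V) ` {child n A B j V | V j. V \<in> K \<and> {A, B} \<subseteq> V \<and> 1 \<le> j \<and> j \<le> n}"
    by (simp only: tets_def subdivide_def image_Un)
  ultimately show ?thesis by (simp only:)
qed

lemma LE_step_subdivide:
  assumes "simplicial_mesh S K" "longest_edge A B K"
  shows "LE_step n (tets K) (tets (subdivide n A B K))"
proof -
  have "A \<noteq> B" using assms by (auto simp: longest_edge_def mesh_edges_def)
  then show ?thesis
    unfolding LE_step_def
    by (intro exI[of _ A] exI[of _ B] conjI longest_mesh_edge_tets[OF assms] tets_subdivide[OF assms(1)])
qed

lemma subdivide_nested:
  assumes "X \<in> tets (subdivide n A B K)"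
  shows "\<exists>Y\<in>tets K. X \<subseteq> Y"
proof -
  obtain V where V: "V \<in> subdivide n A B K" and X: "X = convex hull V" using assms by (auto simp: tets_def)
  from V show ?thesis
  proof (cases rule: subdivide_cases)
    case 1
    then have "X \<in> tets K" using X by (simp add: tets_def)
    then show ?thesis by blast
  next
    case (2 W j)
    then have "V \<subseteq> convex hull W" using child_in_hull by simp
    then have "X \<subseteq> convex hull W" using X by (simp add: hull_minimal)
    moreover have "convex hull W \<in> tets K" using 2 by (simp add: tets_def)
    ultimately show ?thesis by blast
  qed
qed

lemma mesh_size_tets:
  assumes K: "simplicial_mesh S K" and L: "longest_edge A B K"
  shows "mesh_size (tets K) \<le> dist A B" "0 \<le> mesh_size (tets K)"
proof -
  have ne: "finite (tets K)" "tets K \<noteq> {}"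
    using K L by (auto simp: tets_def simplicial_mesh_def longest_edge_def mesh_edges_def)
  have "diameter T \<le> dist A B \<and> 0 \<le> diameter T" if T: "T \<in> tets K" for T
  proof -
    obtain V where V: "V \<in> K" "T = convex hull V" using T by (auto simp: tets_def)
    have c4: "card V = 4" "finite V"
      using K V by (auto simp: simplicial_mesh_def aff_independent_finite)
    obtain u v where uv: "u \<in> V" "v \<in> V"
      and m: "\<And>x y. x \<in> T \<Longrightarrow> y \<in> T \<Longrightarrow> norm (x - y) \<le> norm (u - v)"
    proof -
      have "V \<noteq> {}" using c4 by auto
      then show ?thesis using simplex_extremal_le[OF c4(2)] that unfolding V(2) by blast
    qed
    have "norm (u - v) \<le> dist A B"
      using L uv V by (cases "u = v") (auto simp: longest_edge_def mesh_edges_def dist_norm)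
    then have "diameter T \<le> dist A B" using order_trans[OF m] by (intro diameter_le disjI2 zero_le_dist) blast
    moreover have "bounded T" using V c4 by (simp add: finite_imp_compact compact_imp_bounded bounded_convex_hull)
    then have "0 \<le> diameter T" by (rule diameter_ge_0)
    ultimately show ?thesis by simp
  qed
  moreover have "mesh_size (tets K) \<in> diameter ` tets K"
    unfolding mesh_size_def by (rule Max_in) (use ne in simp_all)
  then obtain T where "T \<in> tets K" "mesh_size (tets K) = diameter T" by (rule imageE)
  ultimately show "mesh_size (tets K) \<le> dist A B" "0 \<le> mesh_size (tets K)" by simp_all
qed

text \<open>
  For \<open>P = (1 - t) A + t B\<close>, Stewart's theorem reads
  \<open>|PC|\<^sup>2 = (1 - t) |AC|\<^sup>2 + t |BC|\<^sup>2 - t (1 - t) |AB|\<^sup>2\<close>, and at the interior division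
  points \<open>t (1 - t)\<close> is at least its value at \<open>t = 1 / n\<close>.
\<close>
lemma dist_division_point_le:
  fixes A B C :: pt
  assumes "dist A C \<le> dist A B" "dist B C \<le> dist A B" "0 < j" "j < n"
  shows "dist (division_point n A B j) C \<le> sqrt (1 - (real n - 1) / (real n)\<^sup>2) * dist A B"
proof -
  define t where "t = real j / n"
  have t: "0 \<le> t" "t \<le> 1" using assms by (auto simp: t_def)
  have "(real j - 1) * (real n - real j - 1) \<ge> 0" using assms by (intro mult_nonneg_nonneg) auto
  then have "real n - 1 \<le> real j * (real n - real j)" by (simp add: algebra_simps)
  then have tt: "(real n - 1) / (real n)\<^sup>2 \<le> t * (1 - t)"
  proof -
    have "t * (1 - t) = real j * (real n - real j) / (real n)\<^sup>2"
      using assms by (simp add: t_def field_simps power2_eq_square)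
    then show ?thesis using \<open>real n - 1 \<le> real j * (real n - real j)\<close> by (simp add: divide_right_mono)
  qed
  define u v where "u = A - C" and "v = B - C"
  have "(dist (division_point n A B j) C)\<^sup>2 = (norm ((1 - t) *\<^sub>R u + t *\<^sub>R v))\<^sup>2"
    unfolding dist_norm division_point_def t_def[symmetric] u_def v_def by (simp add: algebra_simps)
  also have "\<dots> = (1 - t) * (norm u)\<^sup>2 + t * (norm v)\<^sup>2 - t * (1 - t) * (norm (u - v))\<^sup>2"
    unfolding power2_norm_eq_inner inner_add_left inner_add_right inner_diff_left inner_diff_right
      inner_scaleR_left inner_scaleR_right inner_commute[of v u] by (simp add: algebra_simps)
  also have "\<dots> \<le> (1 - t) * (dist A B)\<^sup>2 + t * (dist A B)\<^sup>2 - (real n - 1) / (real n)\<^sup>2 * (dist A B)\<^sup>2"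
  proof -
    have "(norm u)\<^sup>2 \<le> (dist A B)\<^sup>2" "(norm v)\<^sup>2 \<le> (dist A B)\<^sup>2"
      using assms by (auto simp: u_def v_def dist_norm intro: power_mono)
    moreover have "norm (u - v) = dist A B" by (simp add: u_def v_def dist_norm)
    moreover have "(real n - 1) / (real n)\<^sup>2 * (dist A B)\<^sup>2 \<le> t * (1 - t) * (dist A B)\<^sup>2"
      using tt by (rule mult_right_mono) simp
    ultimately show ?thesis
      using mult_left_mono[of "(norm u)\<^sup>2" "(dist A B)\<^sup>2" "1 - t"]
        mult_left_mono[of "(norm v)\<^sup>2" "(dist A B)\<^sup>2" t] t by auto
  qed
  also have "\<dots> = (1 - (real n - 1) / (real n)\<^sup>2) * (dist A B)\<^sup>2" by (simp add: algebra_simps)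
  finally have "dist (division_point n A B j) C \<le> sqrt ((1 - (real n - 1) / (real n)\<^sup>2) * (dist A B)\<^sup>2)"
    by (rule real_le_rsqrt)
  then show ?thesis by (simp add: real_sqrt_mult)
qed

text \<open>
  Every edge of the new mesh is an old edge other than the one cut, or joins an interior
  division point to a vertex off the cut edge, or is one of the \<open>n\<close> sections.
\<close>
lemma subdivide_edges:
  assumes L: "longest_edge A B K" and n: "n \<ge> 2" and ab: "(a, b) \<in> mesh_edges (subdivide n A B K)"
  defines "c \<equiv> sqrt (1 - (real n - 1) / (real n)\<^sup>2)"
  shows "(a, b) \<in> mesh_edges K - {(A, B)} \<or> dist a b \<le> c * dist A B"
proof -
  have le: "dist x y \<le> dist A B" if "V \<in> K" "x \<in> V" "y \<in> V" "x \<noteq> y" for V x y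
    using L that by (auto simp: longest_edge_def mesh_edges_def)
  have AB: "A \<noteq> B" using L by (auto simp: longest_edge_def mesh_edges_def)
  obtain X where X: "X \<in> subdivide n A B K" "a \<in> X" "b \<in> X" and "a \<noteq> b"
    using ab by (auto simp: mesh_edges_def)
  from X(1) show ?thesis
  proof (cases rule: subdivide_cases)
    case 1
    then show ?thesis using X \<open>a \<noteq> b\<close> by (auto simp: mesh_edges_def)
  next
    case (2 V j)
    let ?P = "division_point n A B"
    have new: "(x, y) \<in> mesh_edges K - {(A, B), (B, A)} \<or> dist x y \<le> c * dist A B"
      if "i \<le> n" "x = ?P i" "y \<in> V - {A, B}" for i x y
    proof (cases "i = 0 \<or> i = n")
      case True
      then have x: "x = A \<or> x = B" using that n by auto
      then have "(x, y) \<in> mesh_edges K" using 2 that by (intro mesh_edgesI[of V]) auto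
      then show ?thesis using that x by auto
    next
      case False
      then show ?thesis using that le[OF 2(1,2), of y] le[OF 2(1,3), of y]
        unfolding c_def by (intro disjI2) (auto intro!: dist_division_point_le)
    qed
    have short: "dist (?P (j - 1)) (?P j) \<le> c * dist A B"
    proof -
      have "?P (j - 1) - ?P j = (1 / n) *\<^sub>R (A - B)"
      proof -
        have e: "real (j - 1) / n = real j / n - 1 / n" using 2 by (simp add: of_nat_diff diff_divide_distrib)
        show ?thesis unfolding division_point_def e by (simp add: algebra_simps)
      qed
      then have "dist (?P (j - 1)) (?P j) = 1 / n * dist A B" by (simp add: dist_norm)
      moreover have "1 / n \<le> c" unfolding c_def
      proof (rule real_le_rsqrt)
        have "real n * 1 \<le> real n * real n" using n by (intro mult_left_mono) auto
        then show "(1 / real n)\<^sup>2 \<le> 1 - (real n - 1) / (real n)\<^sup>2"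
          using n by (simp add: field_simps power2_eq_square)
      qed
      ultimately show ?thesis using mult_right_mono[of "1 / n" c "dist A B"] by simp
    qed
    have ends: "x = ?P (j - 1) \<or> x = ?P j \<or> x \<in> V - {A, B}" if "x \<in> X" for x
      using that 2 by (auto simp: child_def)
    have new': "(x, y) \<in> mesh_edges K - {(A, B), (B, A)} \<or> dist x y \<le> c * dist A B"
      if "x = ?P (j - 1) \<or> x = ?P j" "y \<in> V - {A, B}" for x y
    proof -
      have "j - 1 \<le> n" using 2 by simp
      then show ?thesis using new[of j x y] new[of "j - 1" x y] that 2(5) by blast
    qed
    have sym: "(b, a) \<in> mesh_edges K \<Longrightarrow> (a, b) \<in> mesh_edges K" unfolding mesh_edges_def by blast
    consider (old) "a \<in> V - {A, B}" "b \<in> V - {A, B}"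
      | (left) "a = ?P (j - 1) \<or> a = ?P j" "b \<in> V - {A, B}"
      | (right) "b = ?P (j - 1) \<or> b = ?P j" "a \<in> V - {A, B}"
      | (sect) "a = ?P (j - 1)" "b = ?P j" | (sect') "a = ?P j" "b = ?P (j - 1)"
      using ends[OF X(2)] ends[OF X(3)] \<open>a \<noteq> b\<close> by metis
    then show ?thesis
    proof cases
      case old
      then have "(a, b) \<in> mesh_edges K" using 2 \<open>a \<noteq> b\<close> by (intro mesh_edgesI[of V]) auto
      then show ?thesis using old by auto
    next
      case left then show ?thesis using new'[of a b] by blast
    next
      case right
      from new'[OF this] show ?thesis
      proof
        assume "(b, a) \<in> mesh_edges K - {(A, B), (B, A)}"
        then show ?thesis using sym by auto
      qed (simp add: dist_commute)
    next
      case sect then show ?thesis using short by simp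
    next
      case sect' then show ?thesis using short by (simp add: dist_commute)
    qed
  qed
qed

lemma finite_mesh_edges: "simplicial_mesh S K \<Longrightarrow> finite (mesh_edges K)"
proof -
  assume K: "simplicial_mesh S K"
  have "finite (\<Union>V\<in>K. V \<times> V)"
    using K by (intro finite_UN_I finite_cartesian_product) (simp_all add: simplicial_mesh_def aff_independent_finite)
  moreover have "mesh_edges K \<subseteq> (\<Union>V\<in>K. V \<times> V)" unfolding mesh_edges_def by blast
  ultimately show ?thesis by (rule finite_subset[rotated])
qed

lemma longest_edge_exists:
  assumes "simplicial_mesh S K" "K \<noteq> {}"
  shows "\<exists>A B. longest_edge A B K"
proof -
  obtain V where V: "V \<in> K" "card V = 4" using assms by (auto simp: simplicial_mesh_def)
  then have "finite V" using card.infinite[of V] by force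
  then obtain a b where "a \<in> V" "b \<in> V" "a \<noteq> b"
    using card_le_Suc0_iff_eq[of V] V(2) by auto
  then have "mesh_edges K \<noteq> {}" using V by (auto simp: mesh_edges_def)
  then obtain e where "e \<in> mesh_edges K" "\<forall>f\<in>mesh_edges K. dist (fst f) (snd f) \<le> dist (fst e) (snd e)"
  proof -
    let ?D = "(\<lambda>e. dist (fst e) (snd e)) ` mesh_edges K"
    have "finite ?D" using finite_mesh_edges[OF assms(1)] by simp
    moreover from this have "Max ?D \<in> ?D" using \<open>mesh_edges K \<noteq> {}\<close> by (intro Max_in) auto
    ultimately show ?thesis using that Max_ge by fastforce
  qed
  then show ?thesis by (intro exI[of _ "fst e"] exI[of _ "snd e"]) (auto simp: longest_edge_def)
qed

text \<open>
  The maximal length \<open>h\<close> does not increase.  If it never dropped to \<open>c * h m0\<close>, then each step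
  after \<open>m0\<close> would strictly diminish the finite set of edges longer than that.  Hence the limit
  \<open>l\<close> of \<open>h\<close> satisfies \<open>l \<le> c * l\<close>, which forces \<open>l = 0\<close>.
\<close>
lemma longest_edges_tend_to_0:
  assumes K: "\<And>m. simplicial_mesh S (K m)" and L: "\<And>m. longest_edge (A m) (B m) (K m)"
    and step: "\<And>m. K (Suc m) = subdivide n (A m) (B m) (K m)" and n: "n \<ge> 2"
  shows "(\<lambda>m. dist (A m) (B m)) \<longlonglongrightarrow> 0"
proof -
  define c where "c = sqrt (1 - (real n - 1) / (real n)\<^sup>2)"
  define h where "h m = dist (A m) (B m)" for m
  have c: "0 \<le> c" "c < 1"
  proof -
    have "real n * 1 \<le> real n * real n" using n by (intro mult_left_mono) auto
    then have "real n \<le> 1 + real n * real n" by simp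
    then have "(real n - 1) / (real n)\<^sup>2 \<le> 1" using n by (simp add: field_simps power2_eq_square)
    moreover have "(real n - 1) / (real n)\<^sup>2 > 0" using n by simp
    ultimately show "0 \<le> c" "c < 1" by (auto simp: c_def)
  qed
  have le_h: "dist a b \<le> h m" if "(a, b) \<in> mesh_edges (K m)" for a b m
    using L[of m] that by (auto simp: longest_edge_def h_def)
  have edges: "(a, b) \<in> mesh_edges (K m) - {(A m, B m)} \<or> dist a b \<le> c * h m"
    if "(a, b) \<in> mesh_edges (K (Suc m))" for a b m
    using subdivide_edges[OF L n that[unfolded step]] by (simp add: c_def h_def)
  have dec: "decseq h"
  proof (rule decseq_SucI)
    fix m
    have "(A (Suc m), B (Suc m)) \<in> mesh_edges (K (Suc m))" using L[of "Suc m"] by (simp add: longest_edge_def)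
    from edges[OF this] have "h (Suc m) \<le> h m \<or> h (Suc m) \<le> c * h m"
      using le_h by (auto simp: h_def)
    moreover have "c * h m \<le> h m" using c by (simp add: h_def mult_left_le_one_le)
    ultimately show "h (Suc m) \<le> h m" by linarith
  qed
  have shrink: "\<exists>m. h m \<le> c * h m0" for m0
  proof (rule ccontr)
    assume "\<nexists>m. h m \<le> c * h m0"
    then have big: "h m > c * h m0" for m by (simp add: not_le)
    define long where "long m = {(a, b) \<in> mesh_edges (K m). dist a b > c * h m0}" for m
    have fin: "finite (long m)" for m
      using finite_mesh_edges[OF K[of m]] by (simp add: long_def finite_subset case_prod_unfold)
    have "long (Suc m) \<subset> long m" if "m \<ge> m0" for m
    proof -
      have "c * h m \<le> c * h m0" using dec that c by (simp add: decseq_def mult_left_mono)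
      then have "long (Suc m) \<subseteq> long m - {(A m, B m)}"
        using edges[of _ _ m] by (force simp: long_def)
      moreover have "(A m, B m) \<in> long m"
        using L[of m] big[of m] by (simp add: long_def longest_edge_def h_def)
      ultimately show ?thesis by blast
    qed
    then have dec_card: "card (long (Suc m)) < card (long m)" if "m \<ge> m0" for m
      using that fin by (intro psubset_card_mono) auto
    have "card (long (m0 + i)) + i \<le> card (long m0)" for i
    proof (induction i)
      case (Suc i) then show ?case using dec_card[of "m0 + i"] by simp
    qed simp
    from this[of "Suc (card (long m0))"] show False by simp
  qed
  obtain l where l: "h \<longlonglongrightarrow> l" "\<And>m. l \<le> h m"
    using decseq_convergent[OF dec, of 0] by (auto simp: h_def)
  have "l \<le> c * h m" for m using shrink[of m] l(2) by (meson order_trans)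
  moreover have "(\<lambda>m. c * h m) \<longlonglongrightarrow> c * l" using l by (intro tendsto_intros)
  ultimately have "l \<le> c * l" by (meson LIMSEQ_le_const)
  then have "(1 - c) * l \<le> 0" by (simp add: algebra_simps)
  then have "l \<le> 0" using c by (simp add: mult_le_0_iff)
  moreover have "0 \<le> l" using l(1) by (rule LIMSEQ_le_const) (simp add: h_def)
  ultimately have "l = 0" by simp
  then show ?thesis using l(1) by (simp add: h_def[abs_def])
qed

section \<open>The shape of the explicit tetrahedra\<close>

abbreviation e3 :: pt where "e3 \<equiv> axis 3 1"

text \<open>
  The properties of the labelled tetrahedra that matter: \<open>A\<close> stands vertically at height
  \<open>a\<close> above the horizontal triangle \<open>B C D\<close>.  The last three inequalities say that
  \<open>BC\<close> and \<open>CD\<close> are not longer than \<open>BD\<close>, and that \<open>BD\<close> is not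
  shorter than the segment from \<open>C\<close> to the point dividing \<open>AD\<close> next to \<open>D\<close>.
\<close>
definition flat_shape :: "nat \<Rightarrow> real \<Rightarrow> pt \<Rightarrow> pt \<Rightarrow> pt \<Rightarrow> pt \<Rightarrow> bool" where
  "flat_shape n a A B C D \<longleftrightarrow>
     a > 0 \<and> A - B = a *\<^sub>R e3 \<and> (C - B) $ 3 = 0 \<and> (D - B) $ 3 = 0 \<and> a \<le> norm (D - B) \<and>
     (norm (C - B))\<^sup>2 \<le> (norm (D - B))\<^sup>2 \<and> (norm (C - B))\<^sup>2 \<le> 2 * ((C - B) \<bullet> (D - B)) \<and>
     (norm ((C - B) - (1 - 1 / n) *\<^sub>R (D - B)))\<^sup>2 + (a / n)\<^sup>2 \<le> (norm (D - B))\<^sup>2"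

text \<open>
  The linear recursion for the edge vectors at \<open>B\<close>, with \<open>(A, B, C, D)\<close> replaced by
  \<open>(M, N, P, C)\<close>.
\<close>
lemma next_label_differences:
  assumes "n > 0"
  shows "point_M n A D - point_N n B D = (1 / n) *\<^sub>R (A - B)"
    "point_P n B D - point_N n B D = - (1 / n) *\<^sub>R (D - B)"
    "C - point_N n B D = (C - B) - (1 - 1 / n) *\<^sub>R (D - B)"
  using assms by (simp_all add: point_M_def point_N_def point_P_def vec_eq_iff field_simps)

lemma point_M_from_B:
  assumes "n > 0"
  shows "point_M n A D = B + (1 - 1 / n) *\<^sub>R (D - B) + (1 / n) *\<^sub>R (A - B)"
  using assms by (simp add: point_M_def vec_eq_iff field_simps)

lemma division_point_label:
  assumes "n \<ge> 2"
  shows "division_point n A D (n - 1) = point_M n A D"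
    "division_point n B D (n - 1) = point_N n B D"
    "division_point n B D (n - 2) = point_P n B D"
  using assms by (simp_all add: division_point_def point_M_def point_N_def point_P_def vec_eq_iff
      of_nat_diff field_simps)

lemma norm2_3: "(norm (x :: pt))\<^sup>2 = (x $ 1)\<^sup>2 + (x $ 2)\<^sup>2 + (x $ 3)\<^sup>2"
  unfolding power2_norm_eq_inner inner_vec_def sum_3 by (simp add: power2_eq_square)

lemma inner_3: "(x :: pt) \<bullet> y = x $ 1 * y $ 1 + x $ 2 * y $ 2 + x $ 3 * y $ 3"
  by (simp add: inner_vec_def sum_3)

lemma norm2_diff_scaleR:
  fixes c d :: "'a::real_inner"
  shows "(norm (c - r *\<^sub>R d))\<^sup>2 = (norm c)\<^sup>2 - 2 * r * (c \<bullet> d) + r\<^sup>2 * (norm d)\<^sup>2"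
  unfolding power2_norm_eq_inner inner_diff_left inner_diff_right inner_scaleR_left inner_scaleR_right
    inner_commute[of d c] by (simp add: power2_eq_square algebra_simps)

text \<open>
  For \<open>n \<le> 5\<close> the Gram matrix of the horizontal edge vectors \<open>C - B\<close> and \<open>D - B\<close> is
  an eigenvector of the recursion, with factor \<open>1 / n\<close>; the triangles are all similar.
\<close>
lemma labelling_gram_matrix:
  assumes n: "2 \<le> n" "n \<le> 5" and L: "labelling n k = (A, B, C, D)"
  shows "A - B = (1 / n) ^ k *\<^sub>R e3 \<and> (C - B) $ 3 = 0 \<and> (D - B) $ 3 = 0 \<and>
    (C - B) \<bullet> (C - B) = (1 / n) ^ k \<and> (C - B) \<bullet> (D - B) = (real n - 1) / 2 * (1 / n) ^ k \<and>
    (D - B) \<bullet> (D - B) = n * (1 / n) ^ k"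
  using L
proof (induction k arbitrary: A B C D)
  case 0
  have "real n - (real n - 1)\<^sup>2 / 4 \<ge> 0"
  proof -
    have "n = 2 \<or> n = 3 \<or> n = 4 \<or> n = 5" using n by linarith
    then show ?thesis by (elim disjE) (simp_all add: power2_eq_square)
  qed
  then have s: "(sqrt (real n - (real n - 1)\<^sup>2 / 4))\<^sup>2 = real n - (real n - 1)\<^sup>2 / 4" by simp
  have pts: "A = vector [0, 0, 1]" "B = vector [0, 0, 0]" "C = vector [1, 0, 0]"
    "D = vector [(real n - 1) / 2, sqrt (real n - (real n - 1)\<^sup>2 / 4), 0]"
    using 0 n by (simp_all add: initial_labelling_def)
  have "(D - B) \<bullet> (D - B) = ((real n - 1) / 2)\<^sup>2 + (sqrt (real n - (real n - 1)\<^sup>2 / 4))\<^sup>2"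
    unfolding pts inner_3 by (simp only: power2_eq_square) simp
  then have "(D - B) \<bullet> (D - B) = n" unfolding s by (simp add: power_divide)
  then show ?case unfolding pts by (simp add: inner_3 vec_eq_iff forall_3 axis_def)
next
  case (Suc k)
  obtain A' B' C' D' where L': "labelling n k = (A', B', C', D')" by (rule prod_cases4)
  have new: "A = point_M n A' D'" "B = point_N n B' D'" "C = point_P n B' D'" "D = C'"
    using Suc.prems L' by auto
  define c d where "c = C' - B'" and "d = D' - B'"
  define g where "g = (1 / real n) ^ k"
  have IH: "A' - B' = g *\<^sub>R e3" "c $ 3 = 0" "d $ 3 = 0" "c \<bullet> c = g"
    "c \<bullet> d = (real n - 1) / 2 * g" "d \<bullet> d = n * g"
    using Suc.IH[OF L'] by (auto simp: c_def d_def g_def)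
  have n0: "n > 0" using n by simp
  have diffs: "A - B = (1 / n) *\<^sub>R (A' - B')" "C - B = - (1 / n) *\<^sub>R d" "D - B = c - (1 - 1 / n) *\<^sub>R d"
    unfolding new c_def d_def by (rule next_label_differences[OF n0])+
  have g': "(1 / real n) ^ Suc k = g / n" by (simp add: g_def)
  have "(C - B) \<bullet> (C - B) = (1 / n)\<^sup>2 * (d \<bullet> d)"
    unfolding diffs by (simp add: power2_eq_square)
  then have 1: "(C - B) \<bullet> (C - B) = g / n" using IH n0 by (simp add: power2_eq_square)
  have "(C - B) \<bullet> (D - B) = - (1 / n) * (c \<bullet> d - (1 - 1 / n) * (d \<bullet> d))"
    unfolding diffs by (simp add: inner_diff_right inner_commute diff_divide_distrib)
  also have "\<dots> = (real n - 1) / 2 * (g / n)" unfolding IH using n0 by (simp add: field_simps)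
  finally have 2: "(C - B) \<bullet> (D - B) = (real n - 1) / 2 * (g / n)" .
  have "(D - B) \<bullet> (D - B) = c \<bullet> c - 2 * (1 - 1 / n) * (c \<bullet> d) + (1 - 1 / n)\<^sup>2 * (d \<bullet> d)"
    unfolding diffs by (rule norm2_diff_scaleR[unfolded power2_norm_eq_inner])
  also have "\<dots> = n * (g / n)" unfolding IH using n0 by (simp add: field_simps power2_eq_square)
  finally have 3: "(D - B) \<bullet> (D - B) = n * (g / n)" .
  have "A - B = (g / n) *\<^sub>R e3" "(C - B) $ 3 = 0" "(D - B) $ 3 = 0"
    unfolding diffs by (simp_all add: IH)
  then show ?case unfolding g' using 1 2 3 by blast
qed

text \<open>
  The numbers \<open>- p_root n\<close> and \<open>- q_root n\<close> are the eigenvalues of the recursion for the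
  horizontal edge vectors when \<open>n \<ge> 6\<close>.
\<close>
definition p_root :: "nat \<Rightarrow> real" where
  "p_root n = (real n - 1 - sqrt ((real n)\<^sup>2 - 6 * real n + 1)) / (2 * real n)"

definition q_root :: "nat \<Rightarrow> real" where
  "q_root n = (real n - 1 + sqrt ((real n)\<^sup>2 - 6 * real n + 1)) / (2 * real n)"

lemma p_q_roots:
  assumes "n \<ge> 6"
  shows "p_root n * q_root n = 1 / n" "p_root n + q_root n = 1 - 1 / n"
    "0 < p_root n" "p_root n < q_root n" "q_root n < 1"
proof -
  define s where "s = sqrt ((real n)\<^sup>2 - 6 * real n + 1)"
  have "real n * (real n - 6) \<ge> 0" using assms by (intro mult_nonneg_nonneg) auto
  then have ge1: "(real n)\<^sup>2 - 6 * real n + 1 \<ge> 1" by (simp add: power2_eq_square algebra_simps)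
  then have s2: "s\<^sup>2 = (real n)\<^sup>2 - 6 * real n + 1" and s0: "s > 0" by (auto simp: s_def)
  have n0: "real n > 0" using assms by simp
  have pq: "p_root n = (real n - 1 - s) / (2 * n)" "q_root n = (real n - 1 + s) / (2 * n)"
    by (simp_all add: p_root_def q_root_def s_def)
  have "s\<^sup>2 < (real n - 1)\<^sup>2" using s2 n0 by (simp add: power2_eq_square algebra_simps)
  then have sn: "s < real n - 1" using assms by (rule_tac power2_less_imp_less) auto
  have "p_root n * q_root n = ((real n - 1)\<^sup>2 - s\<^sup>2) / (4 * n * n)"
    unfolding pq by (simp add: power2_eq_square algebra_simps)
  then show "p_root n * q_root n = 1 / n"
    using n0 unfolding s2 by (simp add: field_simps power2_eq_square)
  show sum: "p_root n + q_root n = 1 - 1 / n" unfolding pq using n0 by (simp add: field_simps)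
  show p: "0 < p_root n" using sn n0 unfolding pq by simp
  show "p_root n < q_root n" using s0 n0 unfolding pq by (simp add: divide_strict_right_mono)
  have "1 / real n > 0" using n0 by simp
  then show "q_root n < 1" using sum p by linarith
qed

text \<open>
  For \<open>n \<ge> 6\<close> the horizontal coordinates are eigencoordinates of the recursion, so each of them
  follows a geometric progression.
\<close>
lemma labelling_coordinates:
  assumes n: "n \<ge> 6" and L: "labelling n k = (A, B, C, D)"
  defines "p \<equiv> p_root n" and "q \<equiv> q_root n"
  shows "A - B = (1 / n) ^ k *\<^sub>R e3 \<and>
    C - B = vector [p * (- q) ^ k, q * (- p) ^ k, 0] \<and> D - B = vector [(- q) ^ k, (- p) ^ k, 0]"
  using L
proof (induction k arbitrary: A B C D)
  case 0
  have "A = vector [0, 0, 1]" "B = vector [0, 0, 0]" "C = vector [p, q, 0]" "D = vector [1, 1, 0]"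
    using 0 n by (simp_all add: initial_labelling_def Let_def p_def q_def p_root_def q_root_def)
  then show ?case by (simp add: vec_eq_iff forall_3 axis_def)
next
  case (Suc k)
  obtain A' B' C' D' where L': "labelling n k = (A', B', C', D')" by (rule prod_cases4)
  have new: "A = point_M n A' D'" "B = point_N n B' D'" "C = point_P n B' D'" "D = C'"
    using Suc.prems L' by auto
  have n0: "n > 0" using n by simp
  note IH = Suc.IH[OF L']
  have pq: "1 / real n = p * q" "1 - 1 / real n = p + q"
    using p_q_roots[OF n] by (simp_all add: p_def q_def)
  have diffs: "A - B = (1 / n) *\<^sub>R (A' - B')" "C - B = - (1 / n) *\<^sub>R (D' - B')"
      "D - B = (C' - B') - (1 - 1 / n) *\<^sub>R (D' - B')"
    unfolding new by (rule next_label_differences[OF n0])+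
  have "A - B = (1 / n) ^ Suc k *\<^sub>R e3" unfolding diffs using IH by simp
  moreover have "C - B = vector [p * (- q) ^ Suc k, q * (- p) ^ Suc k, 0]"
    unfolding diffs(2) pq(1) using IH by (simp add: vec_eq_iff forall_3)
  moreover have "D - B = vector [(- q) ^ Suc k, (- p) ^ Suc k, 0]"
    unfolding diffs(3) pq(2) using IH by (simp add: vec_eq_iff forall_3 algebra_simps)
  ultimately show ?case by blast
qed

text \<open>
  The squared ratio of height and length of \<open>BD\<close> decreases geometrically.  For \<open>n \<le> 5\<close> the
  squares decrease like \<open>(1 / n) ^ (2 * k)\<close> and \<open>(1 / n) ^ k\<close>.  For \<open>n \<ge> 6\<close> they decrease like
  \<open>(p * q) ^ (2 * k)\<close> and \<open>q ^ (2 * k)\<close>.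
\<close>
lemma labelling_flat_shape:
  assumes n: "n \<ge> 2"
  obtains \<rho> where "0 \<le> \<rho>" "\<rho> < 1"
    "\<forall>k A B C D. labelling n k = (A, B, C, D) \<longrightarrow>
      flat_shape n ((1 / n) ^ k) A B C D \<and> ((1 / n) ^ k)\<^sup>2 \<le> \<rho> ^ k * (norm (D - B))\<^sup>2"
proof (cases "n \<le> 5")
  case True
  show ?thesis
  proof (rule that[of "1 / n"]; (intro allI impI)?)
    show "1 / real n < 1" using n by simp
    fix k A B C D assume L: "labelling n k = (A, B, C, D)"
    define g where "g = (1 / real n) ^ k"
    have g: "0 < g" "g \<le> 1" using n by (auto simp: g_def power_le_one)
    have n2: "real n \<ge> 2" using n by simp
    note S = labelling_gram_matrix[OF n True L, folded g_def, folded power2_norm_eq_inner]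
    have gn: "g\<^sup>2 \<le> g * (real n * g)" using g n2 by (simp add: power2_eq_square)
    have "1 * g \<le> real n * g" using n2 g by (intro mult_right_mono) auto
    then have gn': "g \<le> real n * g" "g * 1 \<le> g * (real n - 1)"
      using n2 g by (auto intro!: mult_left_mono)
    have "g * (real n * g) \<le> 1 * (real n * g)" using g by (intro mult_right_mono) auto
    then have "g\<^sup>2 \<le> (norm (D - B))\<^sup>2" using gn S by simp
    then have a: "g \<le> norm (D - B)" by (rule power2_le_imp_le) simp
    let ?d = "D - B" and ?c = "C - B"
    have gram: "(norm ?c)\<^sup>2 = g" "?c \<bullet> ?d = (real n - 1) / 2 * g" "(norm ?d)\<^sup>2 = n * g"
      using S by blast+
    have "(norm (?c - (1 - 1 / n) *\<^sub>R ?d))\<^sup>2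
        = (norm ?c)\<^sup>2 - 2 * (1 - 1 / n) * (?c \<bullet> ?d) + (1 - 1 / n)\<^sup>2 * (norm ?d)\<^sup>2"
      by (rule norm2_diff_scaleR)
    also have "\<dots> = g" unfolding gram using n2 by (simp add: field_simps power2_eq_square)
    finally have b: "(norm (?c - (1 - 1 / n) *\<^sub>R ?d))\<^sup>2 = g" .
    have "(g / n)\<^sup>2 \<le> g"
    proof -
      have "g / n \<le> g" "g / n \<ge> 0" using g n2 by (auto simp: divide_le_eq)
      then have "(g / n) * (g / n) \<le> g * 1" using g by (intro mult_mono) auto
      then show ?thesis by (simp add: power2_eq_square)
    qed
    moreover have "2 * g \<le> real n * g" using n2 g by (intro mult_right_mono) auto
    ultimately have ineqs: "g + (g / n)\<^sup>2 \<le> n * g" "g \<le> 2 * ((real n - 1) / 2 * g)"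
      by (simp_all add: algebra_simps)
    show "flat_shape n ((1 / n) ^ k) A B C D \<and> ((1 / n) ^ k)\<^sup>2 \<le> (1 / n) ^ k * (norm (D - B))\<^sup>2"
      unfolding flat_shape_def g_def[symmetric] b gram using S g(1) a gn gn'(1) ineqs by blast
  qed simp
next
  case False
  then have n6: "n \<ge> 6" by simp
  define p q where "p = p_root n" and "q = q_root n"
  have pq: "p * q = 1 / n" "p + q = 1 - 1 / n" and p: "0 < p" "p < q" and q: "q < 1"
    using p_q_roots[OF n6] by (simp_all add: p_def q_def)
  show ?thesis
  proof (rule that[of "p\<^sup>2"]; (intro allI impI)?)
    show "p\<^sup>2 < 1" using p q by (simp add: power_less_one_iff abs_square_less_1)
    fix k A B C D assume L: "labelling n k = (A, B, C, D)"
    define X Y where "X = (- q) ^ k" and "Y = (- p) ^ k"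
    note S = labelling_coordinates[OF n6 L, folded p_def q_def, folded X_def Y_def]
    have a: "(1 / real n) ^ k = q ^ k * p ^ k" unfolding pq(1)[symmetric] by (simp add: power_mult_distrib)
    have neg: "((- x) ^ k)\<^sup>2 = (x ^ k)\<^sup>2" for x :: real
      by (cases "even k") simp_all
    have X2: "X\<^sup>2 = (q ^ k)\<^sup>2" and Y2: "Y\<^sup>2 = (p ^ k)\<^sup>2"
      unfolding X_def Y_def by (rule neg)+
    have pk: "0 < p ^ k" "p ^ k \<le> 1" "0 < q ^ k" "q ^ k \<le> 1" using p q by (auto simp: power_le_one)
    let ?d = "D - B" and ?c = "C - B"
    have d2: "(norm ?d)\<^sup>2 = X\<^sup>2 + Y\<^sup>2" and c2: "(norm ?c)\<^sup>2 = p\<^sup>2 * X\<^sup>2 + q\<^sup>2 * Y\<^sup>2"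
      and cd: "?c \<bullet> ?d = p * X\<^sup>2 + q * Y\<^sup>2"
    proof -
      have dC: "C - B = vector [p * X, q * Y, 0]" and dD: "D - B = vector [X, Y, 0]" using S by blast+
      show "(norm ?d)\<^sup>2 = X\<^sup>2 + Y\<^sup>2" "(norm ?c)\<^sup>2 = p\<^sup>2 * X\<^sup>2 + q\<^sup>2 * Y\<^sup>2"
        unfolding dC dD norm2_3 by (simp_all add: power_mult_distrib)
      show "?c \<bullet> ?d = p * X\<^sup>2 + q * Y\<^sup>2"
        unfolding dC dD inner_3 by (simp add: power2_eq_square)
    qed
    have e2: "(norm (?c - (1 - 1 / n) *\<^sub>R ?d))\<^sup>2 = q\<^sup>2 * X\<^sup>2 + p\<^sup>2 * Y\<^sup>2"
    proof -
      have "?c - (p + q) *\<^sub>R ?d = vector [- (q * X), - (p * Y), 0]"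
        using S by (simp add: vec_eq_iff forall_3 algebra_simps)
      then show ?thesis unfolding pq(2)[symmetric] norm2_3 by (simp add: power_mult_distrib)
    qed
    have "((1 / real n) ^ k)\<^sup>2 = (p ^ k)\<^sup>2 * X\<^sup>2" unfolding a X2 by (simp add: power_mult_distrib)
    then have r: "((1 / real n) ^ k)\<^sup>2 \<le> (p ^ k)\<^sup>2 * (norm ?d)\<^sup>2"
      unfolding d2 by (simp add: mult_left_mono)
    have aX: "((1 / real n) ^ k)\<^sup>2 \<le> X\<^sup>2"
      unfolding a X2 using pk by (intro power_mono) (auto simp: mult_left_le)
    then have "((1 / real n) ^ k)\<^sup>2 \<le> (norm ?d)\<^sup>2" unfolding d2 by (simp add: add_increasing2)
    then have ad: "(1 / real n) ^ k \<le> norm ?d" by (rule power2_le_imp_le) simp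
    have pp: "p\<^sup>2 \<le> 1" "q\<^sup>2 \<le> 1" "p\<^sup>2 \<le> 2 * p" "q\<^sup>2 \<le> 2 * q"
      using p q by (auto simp: power2_eq_square mult_le_one)
    \<comment> \<open>follows from \<open>p + q < 1\<close>, since \<open>(1 - p) * (1 + p) \<le> 1\<close>\<close>
    have qp: "q\<^sup>2 * (1 + p\<^sup>2) \<le> 1"
    proof -
      have "1 / real n > 0" using n by simp
      then have "q \<le> 1 - p" using pq(2) by linarith
      then have "q\<^sup>2 \<le> (1 - p)\<^sup>2" using p by (intro power_mono) auto
      moreover have "1 + p\<^sup>2 \<le> (1 + p)\<^sup>2" using p by (simp add: power2_eq_square algebra_simps)
      ultimately have "q\<^sup>2 * (1 + p\<^sup>2) \<le> (1 - p)\<^sup>2 * (1 + p)\<^sup>2" by (intro mult_mono) auto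
      also have "\<dots> = (1 - p\<^sup>2)\<^sup>2" by (simp add: power2_eq_square algebra_simps)
      also have "\<dots> \<le> 1\<^sup>2" using pp p by (intro power_mono) auto
      finally show ?thesis by simp
    qed
    have "((1 / real n) ^ k / n)\<^sup>2 = (p * q)\<^sup>2 * ((1 / real n) ^ k)\<^sup>2"
      unfolding pq(1) by (simp add: power2_eq_square)
    also have "\<dots> \<le> (p * q)\<^sup>2 * X\<^sup>2" using aX by (intro mult_left_mono) auto
    finally have "q\<^sup>2 * X\<^sup>2 + p\<^sup>2 * Y\<^sup>2 + ((1 / real n) ^ k / n)\<^sup>2 \<le> q\<^sup>2 * (1 + p\<^sup>2) * X\<^sup>2 + p\<^sup>2 * Y\<^sup>2"
      by (simp add: power_mult_distrib algebra_simps)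
    also have "\<dots> \<le> 1 * X\<^sup>2 + 1 * Y\<^sup>2" using qp pp by (intro add_mono mult_right_mono) auto
    finally have last: "q\<^sup>2 * X\<^sup>2 + p\<^sup>2 * Y\<^sup>2 + ((1 / real n) ^ k / n)\<^sup>2 \<le> X\<^sup>2 + Y\<^sup>2" by simp
    have mid: "p\<^sup>2 * X\<^sup>2 + q\<^sup>2 * Y\<^sup>2 \<le> 1 * X\<^sup>2 + 1 * Y\<^sup>2"
      "p\<^sup>2 * X\<^sup>2 + q\<^sup>2 * Y\<^sup>2 \<le> (2 * p) * X\<^sup>2 + (2 * q) * Y\<^sup>2"
      using pp by (intro add_mono mult_right_mono; simp)+
    have "(C - B) $ 3 = 0" "(D - B) $ 3 = 0" using S by simp_all
    have "(1 / real n) ^ k > 0" using n by simp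
    show "flat_shape n ((1 / n) ^ k) A B C D \<and> ((1 / n) ^ k)\<^sup>2 \<le> (p\<^sup>2) ^ k * (norm (D - B))\<^sup>2"
    proof -
      have "(p\<^sup>2) ^ k = (p ^ k)\<^sup>2" by (simp only: power_mult[symmetric] mult.commute)
      moreover have "p\<^sup>2 * X\<^sup>2 + q\<^sup>2 * Y\<^sup>2 \<le> X\<^sup>2 + Y\<^sup>2"
        "p\<^sup>2 * X\<^sup>2 + q\<^sup>2 * Y\<^sup>2 \<le> 2 * (p * X\<^sup>2 + q * Y\<^sup>2)"
        using mid by (simp_all add: algebra_simps)
      ultimately show ?thesis
        using S r ad last \<open>(C - B) $ 3 = 0\<close> \<open>(D - B) $ 3 = 0\<close> \<open>(1 / real n) ^ k > 0\<close>
        unfolding flat_shape_def e2 c2 d2 cd by metis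
    qed
  qed (use p in auto)
qed

lemma norm2_add_vertical:
  assumes "u $ 3 = 0"
  shows "(norm (u + s *\<^sub>R e3))\<^sup>2 = (norm u)\<^sup>2 + s\<^sup>2"
  unfolding norm2_3 using assms by (simp add: axis_def)

lemma flat_shape_even_longest:
  assumes S: "flat_shape n a A B C D" and xy: "x \<in> {A, B, C, D}" "y \<in> {A, B, C, D}"
  shows "dist x y \<le> dist A D"
proof -
  define c d where "c = C - B" and "d = D - B"
  have pts: "A = B + a *\<^sub>R e3" "C = B + c" "D = B + d"
    using S by (auto simp: flat_shape_def c_def d_def algebra_simps)
  have z: "c $ 3 = 0" "d $ 3 = 0" using S by (auto simp: flat_shape_def c_def d_def)
  have i: "(norm c)\<^sup>2 \<le> (norm d)\<^sup>2" "(norm c)\<^sup>2 \<le> 2 * (c \<bullet> d)"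
    using S by (auto simp: flat_shape_def c_def d_def)
  have "(dist x y)\<^sup>2 \<le> (dist A D)\<^sup>2"
  proof -
    have cd: "(norm (c - d))\<^sup>2 \<le> (norm d)\<^sup>2"
      using i norm2_diff_scaleR[of c 1 d] by simp
    have e: "a *\<^sub>R e3 - c = - c + a *\<^sub>R e3" "a *\<^sub>R e3 - d = - d + a *\<^sub>R e3" by simp_all
    have v: "(norm (a *\<^sub>R e3))\<^sup>2 = a\<^sup>2" "(norm (a *\<^sub>R e3 - c))\<^sup>2 = (norm c)\<^sup>2 + a\<^sup>2"
      "(norm (a *\<^sub>R e3 - d))\<^sup>2 = (norm d)\<^sup>2 + a\<^sup>2"
      using norm2_add_vertical[of 0 a] norm2_add_vertical[of "- c" a] norm2_add_vertical[of "- d" a] z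
      unfolding e by simp_all
    have le: "a\<^sup>2 \<le> (norm d)\<^sup>2 + a\<^sup>2" "(norm c)\<^sup>2 + a\<^sup>2 \<le> (norm d)\<^sup>2 + a\<^sup>2"
      "(norm c)\<^sup>2 \<le> (norm d)\<^sup>2 + a\<^sup>2" "(norm (c - d))\<^sup>2 \<le> (norm d)\<^sup>2 + a\<^sup>2"
      using i cd by (simp_all add: add_increasing2)
    have sym: "norm (c - a *\<^sub>R e3) = norm (a *\<^sub>R e3 - c)" "norm (d - a *\<^sub>R e3) = norm (a *\<^sub>R e3 - d)"
      "norm (d - c) = norm (c - d)"
      by (rule norm_minus_commute)+
    show ?thesis
      using xy unfolding dist_norm pts
      by (elim insertE emptyE; hypsubst) (simp_all add: sym v le power2_le_imp_le[OF i(1)])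
  qed
  then show ?thesis by (rule power2_le_imp_le) simp
qed

lemma flat_shape_odd_longest:
  assumes n: "n \<ge> 2" and S: "flat_shape n a A B C D"
    and xy: "x \<in> {point_M n A D, B, C, D}" "y \<in> {point_M n A D, B, C, D}"
  shows "dist x y \<le> dist B D"
proof -
  define c d where "c = C - B" and "d = D - B"
  define t where "t = 1 / real n"
  have t: "0 \<le> t" "t \<le> 1 / 2" using n by (auto simp: t_def field_simps)
  have pts: "point_M n A D = B + ((1 - t) *\<^sub>R d + (t * a) *\<^sub>R e3)" "C = B + c" "D = B + d"
    using S n point_M_from_B[of n A D B] by (auto simp: flat_shape_def c_def d_def t_def)
  have z: "c $ 3 = 0" "d $ 3 = 0" using S by (auto simp: flat_shape_def c_def d_def)
  have i: "(norm c)\<^sup>2 \<le> (norm d)\<^sup>2" "(norm c)\<^sup>2 \<le> 2 * (c \<bullet> d)" "a > 0" "a \<le> norm d"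
    and MC: "(norm (c - (1 - t) *\<^sub>R d))\<^sup>2 + (t * a)\<^sup>2 \<le> (norm d)\<^sup>2"
    using S by (auto simp: flat_shape_def c_def d_def t_def)
  have a2: "a\<^sup>2 \<le> (norm d)\<^sup>2" using i by (intro power_mono) auto
  have N: "(norm (r *\<^sub>R d + (t * a) *\<^sub>R e3))\<^sup>2 = r\<^sup>2 * (norm d)\<^sup>2 + t\<^sup>2 * a\<^sup>2" for r
    using norm2_add_vertical[of "r *\<^sub>R d" "t * a"] z by (simp add: power_mult_distrib)
  have le: "norm (r *\<^sub>R d + (t * a) *\<^sub>R e3) \<le> norm d" if "r\<^sup>2 + t\<^sup>2 \<le> 1" for r
  proof (rule power2_le_imp_le)
    have "(norm (r *\<^sub>R d + (t * a) *\<^sub>R e3))\<^sup>2 \<le> r\<^sup>2 * (norm d)\<^sup>2 + t\<^sup>2 * (norm d)\<^sup>2"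
      unfolding N using a2 by (simp add: mult_left_mono)
    also have "\<dots> = (r\<^sup>2 + t\<^sup>2) * (norm d)\<^sup>2" by (simp add: algebra_simps)
    also have "\<dots> \<le> 1 * (norm d)\<^sup>2" using that by (intro mult_right_mono) auto
    finally show "(norm (r *\<^sub>R d + (t * a) *\<^sub>R e3))\<^sup>2 \<le> (norm d)\<^sup>2" by simp
  qed simp
  have t2: "t * t \<le> 1 / 2 * t" using t by (intro mult_right_mono) auto
  have MB: "norm ((1 - t) *\<^sub>R d + (t * a) *\<^sub>R e3) \<le> norm d"
    using t t2 by (rule_tac le) (simp add: power2_eq_square algebra_simps)
  have "norm ((- t) *\<^sub>R d + (t * a) *\<^sub>R e3) \<le> norm d"
    using t t2 by (rule_tac le) (simp add: power2_eq_square algebra_simps)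
  have MD: "norm ((1 - t) *\<^sub>R d + (t * a) *\<^sub>R e3 - d) \<le> norm d"
  proof -
    have "(1 - t) *\<^sub>R d + (t * a) *\<^sub>R e3 - d = (- t) *\<^sub>R d + (t * a) *\<^sub>R e3"
      by (simp add: scaleR_diff_left)
    then show ?thesis using \<open>norm ((- t) *\<^sub>R d + (t * a) *\<^sub>R e3) \<le> norm d\<close> by (simp only:)
  qed
  have "(norm ((1 - t) *\<^sub>R d + (t * a) *\<^sub>R e3 - c))\<^sup>2 = (norm (c - (1 - t) *\<^sub>R d))\<^sup>2 + (t * a)\<^sup>2"
  proof -
    have "(1 - t) *\<^sub>R d + (t * a) *\<^sub>R e3 - c = ((1 - t) *\<^sub>R d - c) + (t * a) *\<^sub>R e3" by simp
    then show ?thesis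
      using norm2_add_vertical[of "(1 - t) *\<^sub>R d - c" "t * a"] z
      by (simp only: norm_minus_commute[of c]) simp
  qed
  then have MC': "norm ((1 - t) *\<^sub>R d + (t * a) *\<^sub>R e3 - c) \<le> norm d"
    using MC by (rule_tac power2_le_imp_le) auto
  have BC: "norm c \<le> norm d" using i(1) by (rule power2_le_imp_le) simp
  have "(norm (c - d))\<^sup>2 = (norm c)\<^sup>2 - 2 * (c \<bullet> d) + (norm d)\<^sup>2"
    by (simp add: power2_norm_eq_inner inner_diff_left inner_diff_right inner_commute)
  then have "(norm (c - d))\<^sup>2 \<le> (norm d)\<^sup>2" using i by linarith
  then have CD: "norm (c - d) \<le> norm d" by (rule power2_le_imp_le) simp
  define m where "m = (1 - t) *\<^sub>R d + (t * a) *\<^sub>R e3"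
  have all: "norm m \<le> norm d" "norm (m - d) \<le> norm d" "norm (m - c) \<le> norm d"
     "norm c \<le> norm d" "norm (c - d) \<le> norm d"
    using MB MD MC' BC CD by (simp_all add: m_def)
  have rev: "norm (d - m) \<le> norm d" "norm (c - m) \<le> norm d" "norm (d - c) \<le> norm d"
    using all by (simp_all only: norm_minus_commute[of d m] norm_minus_commute[of c m] norm_minus_commute[of d c])
  show ?thesis
    using xy[unfolded pts(1)] unfolding pts(2,3) m_def[symmetric] dist_norm
    by (elim insertE emptyE; hypsubst) (simp_all add: all rev)
qed

section \<open>Degeneration of the explicit tetrahedra\<close>

definition labelled_vertices :: "nat \<Rightarrow> nat \<Rightarrow> pt set" where
  "labelled_vertices n k =
     (case labelling n (k div 2) of (A, B, C, D) \<Rightarrow>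
        if even k then {A, B, C, D} else {point_M n A D, B, C, D})"

definition split_edge :: "nat \<Rightarrow> nat \<Rightarrow> pt \<times> pt" where
  "split_edge n k =
     (case labelling n (k div 2) of (A, B, C, D) \<Rightarrow> if even k then (A, D) else (B, D))"

lemma T_seq_hull: "T_seq n k = convex hull (labelled_vertices n k)"
  by (simp add: T_seq_def labelled_vertices_def split: prod.split)

text \<open>
  The determinant \<open>x * w - y * z\<close> is twice the signed area of the base triangle.
\<close>
lemma right_tetrahedron_independent:
  fixes x y z w :: real
  assumes "x * w \<noteq> y * z"
  defines "V \<equiv> {vector [0, 0, 1], vector [0, 0, 0], vector [x, y, 0], vector [z, w, 0]} :: pt set"
  shows "\<not> affine_dependent V" "card V = 4"
proof -
  let ?A = "vector [0, 0, 1] :: pt" and ?B = "vector [0, 0, 0] :: pt"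
    and ?C = "vector [x, y, 0] :: pt" and ?D = "vector [z, w, 0] :: pt"
  have ne: "?A \<noteq> ?B" "?A \<noteq> ?C" "?A \<noteq> ?D" "?B \<noteq> ?C" "?B \<noteq> ?D" "?C \<noteq> ?D"
    using assms(1) by (auto simp: vec_eq_iff forall_3)
  then show "card V = 4" unfolding V_def by simp
  show "\<not> affine_dependent V"
  proof
    assume "affine_dependent V"
    then obtain U where U: "sum U V = 0" "\<exists>v\<in>V. U v \<noteq> 0" "(\<Sum>v\<in>V. U v *\<^sub>R v) = 0"
      using affine_dependent_explicit_finite[of V] unfolding V_def by auto
    have s: "U ?A + U ?B + U ?C + U ?D = 0"
      using U(1) ne unfolding V_def by (simp add: add.assoc)
    have "U ?A *\<^sub>R ?A + U ?B *\<^sub>R ?B + U ?C *\<^sub>R ?C + U ?D *\<^sub>R ?D = 0"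
      using U(3) ne unfolding V_def by (simp add: add.assoc)
    then have c: "U ?C * x + U ?D * z = 0" "U ?C * y + U ?D * w = 0" "U ?A = 0"
      by (simp_all add: vec_eq_iff forall_3)
    have "U ?C * (x * w - y * z) = (U ?C * x + U ?D * z) * w - (U ?C * y + U ?D * w) * z"
      "U ?D * (x * w - y * z) = (U ?C * y + U ?D * w) * x - (U ?C * x + U ?D * z) * y"
      by (simp_all add: algebra_simps)
    then have "U ?C = 0" "U ?D = 0" using assms(1) unfolding c by simp_all
    then show False using s c U(2) unfolding V_def by auto
  qed
qed

lemma initial_independent:
  assumes "n \<ge> 2"
  shows "\<not> affine_dependent (labelled_vertices n 0) \<and> card (labelled_vertices n 0) = 4"
proof (cases "n \<le> 5")
  case True
  have "real n - (real n - 1)\<^sup>2 / 4 > 0"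
  proof -
    have "n = 2 \<or> n = 3 \<or> n = 4 \<or> n = 5" using assms True by linarith
    then show ?thesis by (elim disjE) (simp_all add: power2_eq_square)
  qed
  then have "1 * sqrt (real n - (real n - 1)\<^sup>2 / 4) \<noteq> 0 * ((real n - 1) / 2)" by simp
  from right_tetrahedron_independent[OF this] show ?thesis
    using True by (simp add: labelled_vertices_def initial_labelling_def)
next
  case False
  then have "p_root n * 1 \<noteq> q_root n * 1" using p_q_roots[of n] by simp
  from right_tetrahedron_independent[OF this] show ?thesis
    using False by (simp add: labelled_vertices_def initial_labelling_def Let_def p_root_def q_root_def)
qed

text \<open>
  Each member of the sequence is a piece of its predecessor: the last one (\<open>j = n\<close>) under the
  section of \<open>AD\<close>, and the last but one (\<open>j = n - 1\<close>) under the section of \<open>BD\<close>.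
\<close>
lemma labelled_vertices_Suc:
  assumes n: "n \<ge> 2" and four: "card (labelled_vertices n k) = 4" and e: "split_edge n k = (X, Y)"
  shows "X \<noteq> Y" "{X, Y} \<subseteq> labelled_vertices n k"
    "\<exists>j. 1 \<le> j \<and> j \<le> n \<and> labelled_vertices n (Suc k) = child n X Y j (labelled_vertices n k)"
proof -
  obtain A B C D where L: "labelling n (k div 2) = (A, B, C, D)" by (rule prod_cases4)
  have dist4: "w \<noteq> x \<and> w \<noteq> y \<and> w \<noteq> z \<and> x \<noteq> y \<and> x \<noteq> z \<and> y \<noteq> z"
    if "card {w, x, y, z} = 4" for w x y z :: pt
    using card_distinct[of "[w, x, y, z]"] that by simp
  have "X \<noteq> Y \<and> {X, Y} \<subseteq> labelled_vertices n k \<and> (\<exists>j. 1 \<le> j \<and> j \<le> n \<and>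
    labelled_vertices n (Suc k) = child n X Y j (labelled_vertices n k))"
  proof (cases "even k")
    case True
    have V: "labelled_vertices n k = {A, B, C, D}" "X = A" "Y = D"
      using True L e by (auto simp: labelled_vertices_def split_edge_def)
    have V': "labelled_vertices n (Suc k) = {point_M n A D, B, C, D}"
      using True L by (simp add: labelled_vertices_def)
    have ne: "A \<noteq> B \<and> A \<noteq> C \<and> A \<noteq> D \<and> B \<noteq> C \<and> B \<noteq> D \<and> C \<noteq> D"
      using dist4[OF four[unfolded V(1)]] .
    then have R: "{A, B, C, D} - {A, D} = {B, C}" by auto
    have "division_point n A D n = D" using n by simp
    then have "labelled_vertices n (Suc k) = child n A D n {A, B, C, D}"
      unfolding V' child_def R division_point_label(1)[OF n] by auto
    then show ?thesis unfolding V using n ne by (intro conjI exI[of _ n]) auto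
  next
    case False
    have V: "labelled_vertices n k = {point_M n A D, B, C, D}" "X = B" "Y = D"
      using False L e by (auto simp: labelled_vertices_def split_edge_def)
    have "Suc k div 2 = Suc (k div 2)" using False by presburger
    then have V': "labelled_vertices n (Suc k) = {point_M n A D, point_N n B D, point_P n B D, C}"
      using False L by (simp add: labelled_vertices_def)
    have ne: "point_M n A D \<noteq> B \<and> point_M n A D \<noteq> C \<and> point_M n A D \<noteq> D \<and> B \<noteq> C \<and> B \<noteq> D \<and> C \<noteq> D"
      using dist4[OF four[unfolded V(1)]] .
    then have R: "{point_M n A D, B, C, D} - {B, D} = {point_M n A D, C}" by auto
    have "division_point n B D (n - 1 - 1) = point_P n B D"
      using division_point_label(3)[OF n] by (simp add: numeral_2_eq_2)
    then have "labelled_vertices n (Suc k) = child n B D (n - 1) {point_M n A D, B, C, D}"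
      unfolding V' child_def R division_point_label(2)[OF n] by auto
    then show ?thesis unfolding V using n ne by (intro conjI exI[of _ "n - 1"]) auto
  qed
  then show "X \<noteq> Y" "{X, Y} \<subseteq> labelled_vertices n k"
    "\<exists>j. 1 \<le> j \<and> j \<le> n \<and> labelled_vertices n (Suc k) = child n X Y j (labelled_vertices n k)"
    by blast+
qed

lemma labelled_vertices_independent:
  assumes n: "n \<ge> 2"
  shows "\<not> affine_dependent (labelled_vertices n k) \<and> card (labelled_vertices n k) = 4"
proof (induction k)
  case 0 show ?case using n by (rule initial_independent)
next
  case (Suc k)
  obtain X Y where e: "split_edge n k = (X, Y)" by (cases "split_edge n k")
  obtain j where j: "1 \<le> j" "labelled_vertices n (Suc k) = child n X Y j (labelled_vertices n k)"
    using labelled_vertices_Suc(3)[OF n conjunct2[OF Suc] e] by blast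
  show ?case unfolding j(2)
    using child_independent[of "labelled_vertices n k" X Y j n] Suc j(1) n
      labelled_vertices_Suc(1,2)[OF n conjunct2[OF Suc] e] by auto
qed

lemma split_edge_longest:
  assumes n: "n \<ge> 2" and e: "split_edge n k = (X, Y)"
    and xy: "x \<in> labelled_vertices n k" "y \<in> labelled_vertices n k"
  shows "dist x y \<le> dist X Y"
proof -
  obtain A B C D where L: "labelling n (k div 2) = (A, B, C, D)" by (rule prod_cases4)
  obtain \<rho> :: real where "0 \<le> \<rho>" "\<rho> < 1" and "\<forall>k A B C D. labelling n k = (A, B, C, D) \<longrightarrow>
      flat_shape n ((1 / n) ^ k) A B C D \<and> ((1 / n) ^ k)\<^sup>2 \<le> \<rho> ^ k * (norm (D - B))\<^sup>2"
    by (rule labelling_flat_shape[OF n])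
  with L have S: "flat_shape n ((1 / n) ^ (k div 2)) A B C D" by blast
  show ?thesis
  proof (cases "even k")
    case True
    then show ?thesis using flat_shape_even_longest[OF S] xy e L
      by (simp add: labelled_vertices_def split_edge_def)
  next
    case False
    then show ?thesis using flat_shape_odd_longest[OF n S] xy e L
      by (simp add: labelled_vertices_def split_edge_def)
  qed
qed

lemma labelling_arbitrarily_flat:
  assumes n: "n \<ge> 2" and \<epsilon>: "\<epsilon> > 0"
  obtains k a A B C D where "labelling n k = (A, B, C, D)" "flat_shape n a A B C D"
    "a \<le> \<epsilon> * norm (D - B)"
proof -
  obtain \<rho> :: real where \<rho>: "0 \<le> \<rho>" "\<rho> < 1" and S: "\<forall>k A B C D. labelling n k = (A, B, C, D) \<longrightarrow>
      flat_shape n ((1 / n) ^ k) A B C D \<and> ((1 / n) ^ k)\<^sup>2 \<le> \<rho> ^ k * (norm (D - B))\<^sup>2"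
    by (rule labelling_flat_shape[OF n])
  have "(\<lambda>k. \<rho> ^ k) \<longlonglongrightarrow> 0" using \<rho> by (intro LIMSEQ_power_zero) auto
  then have "\<forall>\<^sub>F k in sequentially. \<rho> ^ k < \<epsilon>\<^sup>2" using \<epsilon> by (intro order_tendstoD) auto
  then obtain k where k: "\<rho> ^ k < \<epsilon>\<^sup>2" by (meson eventually_sequentially order_refl)
  obtain A B C D where L: "labelling n k = (A, B, C, D)" by (rule prod_cases4)
  have "((1 / n) ^ k)\<^sup>2 \<le> \<rho> ^ k * (norm (D - B))\<^sup>2" using S L by blast
  also have "\<dots> \<le> \<epsilon>\<^sup>2 * (norm (D - B))\<^sup>2" using k by (intro mult_right_mono) auto
  also have "\<dots> = (\<epsilon> * norm (D - B))\<^sup>2" by (simp add: power_mult_distrib)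
  finally have "(1 / n) ^ k \<le> \<epsilon> * norm (D - B)" using \<epsilon> by (rule_tac power2_le_imp_le) auto
  then show ?thesis using that[OF L] S L by blast
qed

lemma T_seq_planar_angle:
  assumes n: "n \<ge> 2" and XYZ: "{X, Y, Z} \<subseteq> labelled_vertices n k" "distinct [X, Y, Z]"
  shows "planar_angle X Y Z \<in> angles (T_seq n k)"
  using assms labelled_vertices_independent[OF n, of k]
  unfolding angles_def T_seq_hull by (auto simp: vertices_hull)

text \<open>
  Truncating the bound at \<open>pi\<close>, and at 0 in the next lemma, keeps it in the range where the
  cosine is decreasing.
\<close>
lemma inner_le_of_vec_angle_ge:
  assumes "vec_angle u v \<ge> \<alpha>" "\<alpha> > 0" "u \<noteq> 0" "v \<noteq> 0"
  shows "u \<bullet> v \<le> cos (min \<alpha> pi) * (norm u * norm v)"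
proof -
  let ?x = "(u \<bullet> v) / (norm u * norm v)"
  have x: "\<bar>?x\<bar> \<le> 1" using Cauchy_Schwarz_ineq2[of u v] assms by (simp add: divide_le_eq_1)
  then have x': "- 1 \<le> ?x" "?x \<le> 1" unfolding abs_le_iff by linarith+
  have "min \<alpha> pi \<le> arccos ?x" using assms by (simp add: vec_angle_def)
  from cos_monotone_0_pi_le[OF _ this arccos_ubound[OF x']]
  have "cos (arccos ?x) \<le> cos (min \<alpha> pi)" using assms by simp
  then have "?x \<le> cos (min \<alpha> pi)" using x by (simp add: cos_arccos_abs)
  then show ?thesis using assms by (simp add: divide_le_eq)
qed

lemma inner_ge_of_vec_angle_le:
  assumes "vec_angle u v \<le> \<alpha>" "\<alpha> < pi" "u \<noteq> 0" "v \<noteq> 0"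
  shows "cos (max \<alpha> 0) * (norm u * norm v) \<le> u \<bullet> v"
proof -
  let ?x = "(u \<bullet> v) / (norm u * norm v)"
  have x: "\<bar>?x\<bar> \<le> 1" using Cauchy_Schwarz_ineq2[of u v] assms by (simp add: divide_le_eq_1)
  then have x': "- 1 \<le> ?x" "?x \<le> 1" unfolding abs_le_iff by linarith+
  have "arccos ?x \<le> max \<alpha> 0" using assms by (simp add: vec_angle_def)
  from cos_monotone_0_pi_le[OF arccos_lbound[OF x'] this]
  have "cos (max \<alpha> 0) \<le> cos (arccos ?x)" using assms by simp
  then have "cos (max \<alpha> 0) \<le> ?x" using x by (simp add: cos_arccos_abs)
  then show ?thesis using assms by (simp add: le_divide_eq)
qed

lemma flat_shape_inner:
  assumes "flat_shape n a A B C D"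
  shows "(D - B) \<bullet> (A - B) = 0" "norm (A - B) = a" "a > 0" "D \<noteq> B"
  using assms by (auto simp: flat_shape_def inner_axis)

text \<open>
  The triangle \<open>A B D\<close> has a right angle at \<open>B\<close>, and its leg \<open>AB\<close> becomes arbitrarily
  small in comparison with \<open>BD\<close>, so the angle at \<open>D\<close> tends to 0.
\<close>
lemma T_seq_small_angle:
  assumes n: "n \<ge> 2" and \<alpha>: "\<alpha> > 0"
  shows "\<exists>k. \<exists>\<theta>\<in>angles (T_seq n k). \<theta> < \<alpha>"
proof -
  define \<kappa> where "\<kappa> = cos (min \<alpha> pi)"
  have "\<kappa> < cos 0" unfolding \<kappa>_def using \<alpha> by (intro cos_monotone_0_pi) auto
  then have \<kappa>: "\<kappa> < 1" by simp
  \<comment> \<open>the cosine of the angle at \<open>D\<close> is at least \<open>1 / (1 + \<epsilon>)\<close>, which exceeds \<open>\<kappa>\<close>\<close>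
  define \<epsilon> where "\<epsilon> = (1 - \<kappa>) / 2"
  have \<epsilon>: "\<epsilon> > 0" using \<kappa> by (simp add: \<epsilon>_def)
  obtain k a A B C D where L: "labelling n k = (A, B, C, D)" and S: "flat_shape n a A B C D"
    and a: "a \<le> \<epsilon> * norm (D - B)"
    using labelling_arbitrarily_flat[OF n \<epsilon>] .
  note f = flat_shape_inner[OF S]
  define d where "d = norm (D - B)"
  have d: "d > 0" using f by (simp add: d_def)
  have V: "labelled_vertices n (2 * k) = {A, B, C, D}" using L by (simp add: labelled_vertices_def)
  have AD: "A \<noteq> D"
  proof
    assume "A = D"
    then have "(norm (A - B))\<^sup>2 = 0" using f by (simp add: power2_norm_eq_inner)
    then show False using f by simp
  qed
  have in_angles: "planar_angle A D B \<in> angles (T_seq n (2 * k))"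
    by (rule T_seq_planar_angle[OF n]) (use V AD f in auto)
  have "planar_angle A D B < \<alpha>"
  proof (rule ccontr)
    assume "\<not> planar_angle A D B < \<alpha>"
    then have "(A - D) \<bullet> (B - D) \<le> \<kappa> * (norm (A - D) * norm (B - D))"
      unfolding \<kappa>_def planar_angle_def using AD f \<alpha> by (intro inner_le_of_vec_angle_ge) auto
    moreover have "(A - D) \<bullet> (B - D) = d\<^sup>2"
    proof -
      have expand: "(u - v) \<bullet> (- v) = v \<bullet> v - v \<bullet> u" for u v :: pt
        by (simp add: inner_diff_left inner_diff_right inner_commute)
      have "(A - D) \<bullet> (B - D) = ((A - B) - (D - B)) \<bullet> (- (D - B))" by simp
      also have "\<dots> = (D - B) \<bullet> (D - B) - (D - B) \<bullet> (A - B)" by (rule expand)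
      finally show ?thesis using f by (simp add: d_def power2_norm_eq_inner)
    qed
    moreover have "norm (B - D) = d" by (simp add: d_def norm_minus_commute)
    ultimately have "d * d \<le> \<kappa> * norm (A - D) * d" by (simp add: power2_eq_square mult.assoc)
    then have le: "d \<le> \<kappa> * norm (A - D)" using d by (simp add: mult_le_cancel_right)
    moreover have "norm (A - D) \<le> a + d"
      using norm_triangle_ineq4[of "A - B" "D - B"] f by (simp add: d_def)
    moreover have "norm (A - D) > 0" using AD by simp
    moreover from this le d have "\<kappa> > 0" by (metis less_le_trans zero_less_mult_pos2)
    ultimately have "d \<le> \<kappa> * (a + d)" by (meson less_imp_le mult_left_mono order_trans)
    also have "\<dots> \<le> \<kappa> * (\<epsilon> * d + d)" using a \<open>\<kappa> > 0\<close> by (simp add: d_def)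
    also have "\<dots> = (\<kappa> * (1 + \<epsilon>)) * d" by (simp add: algebra_simps)
    finally have "1 \<le> \<kappa> * (1 + \<epsilon>)" using d by simp
    moreover have "\<kappa> * \<epsilon> \<le> 1 * \<epsilon>" using \<kappa> \<epsilon> by (intro mult_right_mono) auto
    ultimately have "1 \<le> \<kappa> + \<epsilon>" by (simp add: algebra_simps)
    then show False using \<kappa> by (simp add: \<epsilon>_def field_simps)
  qed
  then show ?thesis using in_angles by blast
qed

text \<open>
  The point \<open>M\<close> lies at height \<open>a / n\<close> above the interior point of \<open>BD\<close> that divides it in
  the ratio \<open>n - 1\<close> to 1.  As \<open>a\<close> becomes small in comparison with \<open>BD\<close>, the triangle
  \<open>B M D\<close> degenerates to a segment with \<open>M\<close> in its interior.
\<close>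
lemma T_seq_large_angle:
  assumes n: "n \<ge> 2" and \<alpha>: "\<alpha> < pi"
  shows "\<exists>k. \<exists>\<theta>\<in>angles (T_seq n k). \<theta> > \<alpha>"
proof -
  define \<delta> where "\<delta> = 1 + cos (max \<alpha> 0)"
  have "cos pi < cos (max \<alpha> 0)" using \<alpha> by (intro cos_monotone_0_pi) auto
  then have \<delta>: "\<delta> > 0" "\<delta> \<le> 2" by (simp_all add: \<delta>_def)
  \<comment> \<open>the cosine of the angle at \<open>M\<close> is at most \<open>- (1 - 4 * \<epsilon>)\<close>, which is less than \<open>\<delta> - 1\<close>;
    as \<open>\<delta> \<le> 2\<close>, also \<open>\<epsilon> \<le> 1\<close>\<close>
  define \<epsilon> where "\<epsilon> = \<delta> / 10"
  have \<epsilon>: "\<epsilon> > 0" "\<epsilon> \<le> 1" using \<delta> by (simp_all add: \<epsilon>_def)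
  obtain k a A B C D where L: "labelling n k = (A, B, C, D)" and S: "flat_shape n a A B C D"
    and a: "a \<le> \<epsilon> * norm (D - B)"
    using labelling_arbitrarily_flat[OF n \<epsilon>(1)] .
  note f = flat_shape_inner[OF S]
  define d where "d = norm (D - B)"
  have d: "d > 0" using f by (simp add: d_def)
  define M where "M = point_M n A D"
  have V: "labelled_vertices n (2 * k + 1) = {M, B, C, D}"
    using L by (simp add: labelled_vertices_def M_def)
  have "card {M, B, C, D} = 4" using labelled_vertices_independent[OF n, of "2 * k + 1"] V by simp
  then have MBD: "M \<noteq> B" "M \<noteq> D" using card_distinct[of "[M, B, C, D]"] by simp_all
  have in_angles: "planar_angle B M D \<in> angles (T_seq n (2 * k + 1))"
    by (rule T_seq_planar_angle[OF n]) (use V MBD f in auto)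
  define m where "m = real n - 1"
  have m: "m \<ge> 1" using n by (simp add: m_def)
  have n0: "real n > 0" using n by simp
  have BM: "B - M = - (1 / n) *\<^sub>R (m *\<^sub>R (D - B) + (A - B))"
    and DM: "D - M = (1 / n) *\<^sub>R ((D - B) - (A - B))"
    using n0 unfolding M_def m_def by (simp_all add: point_M_def vec_eq_iff field_simps)
  have "planar_angle B M D > \<alpha>"
  proof (rule ccontr)
    assume "\<not> planar_angle B M D > \<alpha>"
    then have "cos (max \<alpha> 0) * (norm (B - M) * norm (D - M)) \<le> (B - M) \<bullet> (D - M)"
      unfolding planar_angle_def using MBD f \<alpha> by (intro inner_ge_of_vec_angle_le) auto
    then have *: "(\<delta> - 1) * (norm (B - M) * norm (D - M)) \<le> (B - M) \<bullet> (D - M)" by (simp add: \<delta>_def)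
    let ?u = "m *\<^sub>R (D - B) + (A - B)" and ?v = "(D - B) - (A - B)"
    have BDM: "(B - M) \<bullet> (D - M) = - (1 / n)\<^sup>2 * (?u \<bullet> ?v)"
      unfolding BM DM inner_scaleR_left inner_scaleR_right by (simp add: power2_eq_square)
    have N: "norm (B - M) * norm (D - M) = (1 / n)\<^sup>2 * (norm ?u * norm ?v)"
      unfolding BM DM norm_scaleR by (simp add: power2_eq_square)
    have "?u \<bullet> ?v = m * d\<^sup>2 - a\<^sup>2"
    proof -
      have expand: "(m *\<^sub>R v + u) \<bullet> (v - u) = m * (v \<bullet> v) - m * (v \<bullet> u) + v \<bullet> u - u \<bullet> u" for u v :: pt
        by (simp add: inner_add_left inner_diff_right inner_commute algebra_simps)
      have "?u \<bullet> ?v = m * ((D - B) \<bullet> (D - B)) - m * ((D - B) \<bullet> (A - B)) + (D - B) \<bullet> (A - B)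
          - (A - B) \<bullet> (A - B)"
        by (rule expand)
      then show ?thesis using f by (simp add: d_def power2_norm_eq_inner[symmetric])
    qed
    moreover have "(\<delta> - 1) * (norm ?u * norm ?v) \<le> - (?u \<bullet> ?v)"
    proof -
      have "(1 / n)\<^sup>2 * ((\<delta> - 1) * (norm ?u * norm ?v)) \<le> (1 / n)\<^sup>2 * (- (?u \<bullet> ?v))"
        using * unfolding BDM N by (simp only: mult.left_commute mult_minus_left mult_minus_right)
      then show ?thesis using n0 by (simp only: mult_le_cancel_left_pos zero_less_power zero_less_divide_1_iff)
    qed
    ultimately have uv: "m * d\<^sup>2 - a\<^sup>2 \<le> (1 - \<delta>) * (norm ?u * norm ?v)"
      unfolding left_diff_distrib by linarith
    have nu: "norm ?u \<le> m * d + a" using norm_triangle_ineq[of "m *\<^sub>R (D - B)" "A - B"] m f by (simp add: d_def)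
    have nv: "norm ?v \<le> d + a" using norm_triangle_ineq4[of "D - B" "A - B"] f by (simp add: d_def)
    have ad: "a \<le> \<epsilon> * d" "0 < a" using a f by (simp_all add: d_def)
    have aa: "a\<^sup>2 \<le> \<epsilon> * d\<^sup>2"
    proof -
      have "\<epsilon> * d \<le> 1 * d" using \<epsilon> d by (intro mult_right_mono) auto
      then have "a \<le> d" using ad(1) by linarith
      then have "a * a \<le> (\<epsilon> * d) * d" using ad \<epsilon> d by (intro mult_mono) auto
      then show ?thesis by (simp add: power2_eq_square)
    qed
    have md: "\<epsilon> * d\<^sup>2 \<le> m * (\<epsilon> * d\<^sup>2)"
      using mult_right_mono[OF m, of "\<epsilon> * d\<^sup>2"] \<epsilon> by simp
    have pos: "m * d\<^sup>2 - a\<^sup>2 \<ge> (1 - \<epsilon>) * (m * d\<^sup>2)" using aa md by (simp add: algebra_simps)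
    have "norm ?u * norm ?v \<le> (m * d + a) * (d + a)" using nu nv m d ad by (intro mult_mono) auto
    also have "\<dots> \<le> (1 + 3 * \<epsilon>) * (m * d\<^sup>2)"
    proof -
      have "a * d \<le> \<epsilon> * d * d" using ad d by (intro mult_right_mono) auto
      then have 1: "a * d \<le> \<epsilon> * d\<^sup>2" by (simp add: power2_eq_square mult.assoc)
      have 2: "m * (a * d) \<le> m * (\<epsilon> * d\<^sup>2)" using 1 m by (intro mult_left_mono) auto
      have "(m * d + a) * (d + a) = m * d\<^sup>2 + m * (a * d) + a * d + a\<^sup>2"
        by (simp add: power2_eq_square algebra_simps)
      also have "\<dots> \<le> m * d\<^sup>2 + 3 * (m * (\<epsilon> * d\<^sup>2))" using 1 2 aa md by linarith
      finally show ?thesis by (simp add: algebra_simps)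
    qed
    finally have up: "norm ?u * norm ?v \<le> (1 + 3 * \<epsilon>) * (m * d\<^sup>2)" .
    have md0: "m * d\<^sup>2 > 0" using m d by simp
    have "(1 - \<epsilon>) * (m * d\<^sup>2) > 0"
      using \<delta> m d by (intro mult_pos_pos) (simp_all add: \<epsilon>_def)
    then have "(1 - \<delta>) * (norm ?u * norm ?v) > 0" using pos uv by linarith
    then have "1 - \<delta> > 0"
      using mult_nonpos_nonneg[of "1 - \<delta>" "norm ?u * norm ?v"] by (meson mult_nonneg_nonneg norm_ge_zero not_le)
    then have "(1 - \<delta>) * (norm ?u * norm ?v) \<le> (1 - \<delta>) * ((1 + 3 * \<epsilon>) * (m * d\<^sup>2))"
      using up by (intro mult_left_mono) auto
    then have "(1 - \<epsilon>) * (m * d\<^sup>2) \<le> ((1 - \<delta>) * (1 + 3 * \<epsilon>)) * (m * d\<^sup>2)"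
      using pos uv by (simp add: mult.assoc)
    then have "1 - \<epsilon> \<le> (1 - \<delta>) * (1 + 3 * \<epsilon>)" using md0 by (simp only: mult_le_cancel_right_pos)
    moreover have "0 \<le> \<delta> * (3 * \<epsilon>)" using \<delta> \<epsilon> by simp
    ultimately have "\<delta> \<le> 4 * \<epsilon>" by (simp add: algebra_simps)
    then show False using \<delta> by (simp add: \<epsilon>_def)
  qed
  then show ?thesis using in_angles by blast
qed

text \<open>
  The highest and the lowest point of a ball in a horizontal slab lie in that slab.
\<close>
lemma inradius_flat_le:
  fixes T :: "pt set"
  assumes slab: "\<And>x. x \<in> T \<Longrightarrow> z \<le> x $ 3 \<and> x $ 3 \<le> z + a" and int: "interior T \<noteq> {}"
  shows "0 < inradius T" "inradius T \<le> a"
proof -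
  let ?R = "{r. 0 \<le> r \<and> (\<exists>c. cball c r \<subseteq> T)}"
  have le: "r \<le> a" if r: "r \<in> ?R" for r
  proof -
    obtain c where c: "cball c r \<subseteq> T" "0 \<le> r" using r by auto
    have "c + r *\<^sub>R e3 \<in> T" "c - r *\<^sub>R e3 \<in> T"
      using c by (auto intro!: subsetD[OF c(1)] simp: dist_norm)
    then have "(c + r *\<^sub>R e3) $ 3 \<le> z + a" "z \<le> (c - r *\<^sub>R e3) $ 3" using slab by blast+
    then show "r \<le> a" using c by (simp add: axis_def)
  qed
  obtain c where "c \<in> interior T" using int by blast
  then obtain r where r: "r > 0" "cball c r \<subseteq> T" by (auto simp: mem_interior_cball)
  then have mem: "r \<in> ?R" by auto
  have "bdd_above ?R" using le by (intro bdd_aboveI) auto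
  then have "r \<le> inradius T" unfolding inradius_def using mem by (intro cSup_upper)
  then show "0 < inradius T" using r by simp
  show "inradius T \<le> a" unfolding inradius_def using mem le by (intro cSup_least) auto
qed

lemma independent_hull_interior:
  fixes V :: "pt set"
  assumes "\<not> affine_dependent V" "card V = 4"
  shows "interior (convex hull V) \<noteq> {}"
proof -
  have "aff_dim V = 3" using assms by (simp add: affine_independent_iff_card)
  then have "affine hull (convex hull V) = UNIV"
    using affine_hull_UNIV[of V] aff_dim_eq_full[of V] by (simp add: affine_hull_convex_hull)
  then have "rel_interior (convex hull V) = interior (convex hull V)" by (rule rel_interior_interior)
  moreover have "rel_interior (convex hull V) \<noteq> {}" using assms by (simp add: rel_interior_eq_empty) force
  ultimately show ?thesis by simp
qed

text \<open>
  The tetrahedron lies in a horizontal slab of height \<open>a\<close> and contains the segment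
  \<open>BD\<close>.
\<close>
lemma T_seq_not_shape_regular:
  assumes n: "n \<ge> 2"
  shows "\<exists>k. diameter (T_seq n k) / inradius (T_seq n k) > K"
proof -
  define \<epsilon> where "\<epsilon> = 1 / (\<bar>K\<bar> + 1)"
  have \<epsilon>: "\<epsilon> > 0" by (simp add: \<epsilon>_def)
  obtain k a A B C D where L: "labelling n k = (A, B, C, D)" and S: "flat_shape n a A B C D"
    and a: "a \<le> \<epsilon> * norm (D - B)"
    using labelling_arbitrarily_flat[OF n \<epsilon>] .
  let ?T = "T_seq n (2 * k)"
  have V: "labelled_vertices n (2 * k) = {A, B, C, D}" using L by (simp add: labelled_vertices_def)
  then have T: "?T = convex hull {A, B, C, D}" by (simp add: T_seq_hull)
  have "{A, B, C, D} \<subseteq> {x. B $ 3 \<le> x $ 3} \<inter> {x. x $ 3 \<le> B $ 3 + a}"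
  proof -
    have "A = B + a *\<^sub>R e3" using S by (simp add: flat_shape_def algebra_simps)
    moreover have "C $ 3 = B $ 3" "D $ 3 = B $ 3" "a > 0" using S by (auto simp: flat_shape_def)
    ultimately show ?thesis by (simp add: axis_def)
  qed
  moreover have "convex ({x :: pt. B $ 3 \<le> x $ 3} \<inter> {x. x $ 3 \<le> B $ 3 + a})"
    using convex_halfspace_ge[of "B $ 3" e3] convex_halfspace_le[of e3 "B $ 3 + a"]
    by (intro convex_Int) (simp_all add: inner_axis' )
  ultimately have "?T \<subseteq> {x. B $ 3 \<le> x $ 3} \<inter> {x. x $ 3 \<le> B $ 3 + a}"
    unfolding T by (rule hull_minimal)
  then have slab: "\<And>x. x \<in> ?T \<Longrightarrow> B $ 3 \<le> x $ 3 \<and> x $ 3 \<le> B $ 3 + a" by blast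
  have "interior ?T \<noteq> {}"
    unfolding T_seq_hull using labelled_vertices_independent[OF n] by (intro independent_hull_interior) auto
  note r = inradius_flat_le[OF slab this]
  have "bounded ?T" unfolding T by (simp add: bounded_convex_hull)
  moreover have "B \<in> ?T" "D \<in> ?T" unfolding T by (simp_all add: hull_inc)
  ultimately have "norm (D - B) \<le> diameter ?T"
    by (metis diameter_bounded_bound dist_norm)
  moreover have "(\<bar>K\<bar> + 1) * a \<le> norm (D - B)"
    using a by (simp add: \<epsilon>_def field_simps)
  moreover have "(\<bar>K\<bar> + 1) * inradius ?T \<le> (\<bar>K\<bar> + 1) * a" using r by (intro mult_left_mono) auto
  ultimately have "\<bar>K\<bar> + 1 \<le> diameter ?T / inradius ?T" using r by (simp add: le_divide_eq)
  then show ?thesis by (intro exI[of _ "2 * k"]) linarith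
qed

section \<open>The steered run\<close>

text \<open>
  The state of the steered run: the mesh, and the index of the member of the explicit sequence
  that it contains at present.
\<close>
primrec run_state :: "nat \<Rightarrow> nat \<Rightarrow> pt set set \<times> nat" where
  "run_state n 0 = ({labelled_vertices n 0}, 0)"
| "run_state n (Suc m) =
     (case run_state n m of (K, k) \<Rightarrow>
        if case_prod longest_edge (split_edge n k) K
        then (case_prod (subdivide n) (split_edge n k) K, Suc k)
        else (case_prod (subdivide n) (SOME e. case_prod longest_edge e K) K, k))"

definition run_mesh :: "nat \<Rightarrow> nat \<Rightarrow> pt set set" where
  "run_mesh n m = fst (run_state n m)"

definition target :: "nat \<Rightarrow> nat \<Rightarrow> nat" where
  "target n m = snd (run_state n m)"

lemma run_start: "run_mesh n 0 = {labelled_vertices n 0}" "target n 0 = 0"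
  by (simp_all add: run_mesh_def target_def)

lemma subdivide_keeps_unsplit:
  "V \<in> K \<Longrightarrow> \<not> {A, B} \<subseteq> V \<Longrightarrow> V \<in> subdivide n A B K"
  by (auto simp: subdivide_def)

text \<open>
  The current member survives an arbitrary choice: if the chosen edge belonged to it, then its own
  longest edge would be a longest edge of the mesh, and would have been preferred.
\<close>
lemma run_invariant:
  assumes n: "n \<ge> 2"
  shows "simplicial_mesh (T_seq n 0) (run_mesh n m) \<and>
    labelled_vertices n (target n m) \<in> run_mesh n m"
proof (induction m)
  case 0
  show ?case
    using labelled_vertices_independent[OF n, of 0]
    by (simp add: run_start simplicial_mesh_def T_seq_hull)
next
  case (Suc m)
  define K k where "K = run_mesh n m" and "k = target n m"
  have st: "run_state n m = (K, k)" by (simp add: K_def k_def run_mesh_def target_def)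
  have K: "simplicial_mesh (T_seq n 0) K" and V: "labelled_vertices n k \<in> K"
    using Suc by (simp_all add: K_def k_def)
  obtain X Y where e: "split_edge n k = (X, Y)" by (cases "split_edge n k")
  note four = conjunct2[OF labelled_vertices_independent[OF n, of k]]
  note XY = labelled_vertices_Suc(1,2)[OF n four e]
  show ?case
  proof (cases "longest_edge X Y K")
    case True
    then have new: "run_mesh n (Suc m) = subdivide n X Y K" "target n (Suc m) = Suc k"
      by (simp_all add: run_mesh_def target_def st e)
    obtain j where "1 \<le> j" "j \<le> n"
      "labelled_vertices n (Suc k) = child n X Y j (labelled_vertices n k)"
      using labelled_vertices_Suc(3)[OF n four e] by blast
    then have "labelled_vertices n (Suc k) \<in> subdivide n X Y K"
      unfolding subdivide_def using V XY(2) by blast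
    then show ?thesis unfolding new using subdivide_simplicial_mesh[OF K XY(1)] n by simp
  next
    case False
    define f where "f = (SOME e. case_prod longest_edge e K)"
    have "\<exists>e. case_prod longest_edge e K" using longest_edge_exists[OF K] V by force
    then have "case_prod longest_edge f K" unfolding f_def by (rule someI_ex)
    then obtain A B where f: "f = (A, B)" and AB: "longest_edge A B K" by (cases f) auto
    have new: "run_mesh n (Suc m) = subdivide n A B K" "target n (Suc m) = k"
      using False by (simp_all add: run_mesh_def target_def st e f_def[symmetric] f)
    have "\<not> {A, B} \<subseteq> labelled_vertices n k"
    proof
      assume "{A, B} \<subseteq> labelled_vertices n k"
      then have "dist A B \<le> dist X Y" using split_edge_longest[OF n e] by simp
      then have "longest_edge X Y K"
        using AB mesh_edgesI[OF V] XY unfolding longest_edge_def by fastforce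
      then show False using False by simp
    qed
    then have "labelled_vertices n k \<in> subdivide n A B K" by (rule subdivide_keeps_unsplit[OF V])
    moreover have "A \<noteq> B" using AB by (auto simp: longest_edge_def mesh_edges_def)
    ultimately show ?thesis unfolding new using subdivide_simplicial_mesh[OF K] n by simp
  qed
qed

lemma run_step:
  assumes n: "n \<ge> 2"
  shows "\<exists>A B. longest_edge A B (run_mesh n m) \<and> run_mesh n (Suc m) = subdivide n A B (run_mesh n m)"
    "target n (Suc m) = target n m \<or> target n (Suc m) = Suc (target n m)"
    "case_prod longest_edge (split_edge n (target n m)) (run_mesh n m) \<Longrightarrow>
      target n (Suc m) = Suc (target n m)"
proof -
  define K k where "K = run_mesh n m" and "k = target n m"
  have st: "run_state n m = (K, k)" by (simp add: K_def k_def run_mesh_def target_def)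
  show "case_prod longest_edge (split_edge n (target n m)) (run_mesh n m) \<Longrightarrow>
      target n (Suc m) = Suc (target n m)"
    unfolding K_def[symmetric] k_def[symmetric] by (simp add: target_def st)
  show "target n (Suc m) = target n m \<or> target n (Suc m) = Suc (target n m)"
    by (simp add: target_def st)
  have K: "simplicial_mesh (T_seq n 0) K" "K \<noteq> {}"
    using run_invariant[OF n, of m] by (auto simp: K_def)
  define f where "f = (SOME e. case_prod longest_edge e K)"
  have "\<exists>e. case_prod longest_edge e K" using longest_edge_exists[OF K] by force
  then have f: "case_prod longest_edge f K" unfolding f_def by (rule someI_ex)
  define e where "e = (if case_prod longest_edge (split_edge n k) K then split_edge n k else f)"
  have "run_mesh n (Suc m) = case_prod (subdivide n) e K"
    by (simp add: run_mesh_def st e_def f_def)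
  moreover have "case_prod longest_edge e K" using f by (simp add: e_def)
  ultimately show "\<exists>A B. longest_edge A B (run_mesh n m) \<and>
      run_mesh n (Suc m) = subdivide n A B (run_mesh n m)"
    unfolding K_def[symmetric] by (cases e) auto
qed

lemma run_longest_edges:
  assumes n: "n \<ge> 2"
  obtains A B where "\<And>m. longest_edge (A m) (B m) (run_mesh n m)"
    "\<And>m. run_mesh n (Suc m) = subdivide n (A m) (B m) (run_mesh n m)"
    "(\<lambda>m. dist (A m) (B m)) \<longlonglongrightarrow> 0"
proof -
  have "\<forall>m. \<exists>A B. longest_edge A B (run_mesh n m) \<and> run_mesh n (Suc m) = subdivide n A B (run_mesh n m)"
    using run_step(1)[OF n] by blast
  then obtain A B where AB: "\<And>m. longest_edge (A m) (B m) (run_mesh n m)"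
      "\<And>m. run_mesh n (Suc m) = subdivide n (A m) (B m) (run_mesh n m)"
    by metis
  moreover have "\<And>m. simplicial_mesh (T_seq n 0) (run_mesh n m)" using run_invariant[OF n] by blast
  ultimately show ?thesis using that longest_edges_tend_to_0[of "T_seq n 0" "run_mesh n" A B n] n by blast
qed

text \<open>
  If the index stopped at \<open>k\<close>, then \<open>T_seq n k\<close> would stay in the mesh forever, and its longest
  edge would be a positive lower bound of the maximal edge lengths, which tend to 0.
\<close>
lemma target_reaches:
  assumes n: "n \<ge> 2"
  shows "\<exists>m. target n m = k"
proof (induction k)
  case 0 show ?case using run_start by blast
next
  case (Suc k)
  then obtain m0 where m0: "target n m0 = k" by blast
  obtain A B where AB: "\<And>m. longest_edge (A m) (B m) (run_mesh n m)"
    and lim: "(\<lambda>m. dist (A m) (B m)) \<longlonglongrightarrow> 0"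
    using run_longest_edges[OF n] by metis
  show ?case
  proof (rule ccontr)
    assume never: "\<nexists>m. target n m = Suc k"
    have stuck: "target n (m0 + i) = k" for i
    proof (induction i)
      case (Suc i) then show ?case using run_step(2)[OF n, of "m0 + i"] never by auto
    qed (simp add: m0)
    obtain X Y where e: "split_edge n k = (X, Y)" by (cases "split_edge n k")
    note XY = labelled_vertices_Suc(1,2)[OF n conjunct2[OF labelled_vertices_independent[OF n]] e]
    have le: "dist X Y \<le> dist (A m) (B m)" if "m \<ge> m0" for m
    proof -
      have "target n m = k" using stuck[of "m - m0"] that by simp
      then have "labelled_vertices n k \<in> run_mesh n m" using run_invariant[OF n, of m] by simp
      then have "(X, Y) \<in> mesh_edges (run_mesh n m)" using XY by (intro mesh_edgesI) auto
      then show ?thesis using AB[of m] by (auto simp: longest_edge_def)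
    qed
    have "dist X Y \<le> 0" using lim le by (intro LIMSEQ_le_const) blast+
    then show False using XY(1) by simp
  qed
qed

lemma target_mono:
  assumes "n \<ge> 2" shows "mono (target n)"
  unfolding mono_iff_le_Suc
proof
  fix m show "target n m \<le> target n (Suc m)" using run_step(2)[OF assms, of m] by auto
qed

theorem theorem2:
  fixes n :: nat
  assumes "n \<ge> 2"
  shows "\<exists>(\<Omega> :: (real ^ 3) set) (\<T> :: nat \<Rightarrow> (real ^ 3) set set).
    (\<exists>T. tetrahedron T \<and> \<Omega> = interior T) \<and>
    (\<forall>m. tetrahedral_partition \<Omega> (\<T> m) \<and> conforming (\<T> m)) \<and>
    nested \<T> \<and>
    LE_algorithm_run n \<Omega> \<T> \<and>
    (\<lambda>m. mesh_size (\<T> m)) \<longlonglongrightarrow> 0 \<and>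
    \<not> (\<exists>C. \<forall>m. \<forall>T\<in>\<T> m. diameter T / inradius T \<le> C) \<and>
    \<not> (\<exists>\<alpha>\<^sub>0>0. \<forall>m. \<forall>T\<in>\<T> m. \<forall>\<theta>\<in>angles T. \<theta> \<ge> \<alpha>\<^sub>0) \<and>
    \<not> (\<exists>\<alpha>\<^sub>1<pi. \<forall>m. \<forall>T\<in>\<T> m. \<forall>\<theta>\<in>angles T. \<theta> \<le> \<alpha>\<^sub>1) \<and>
    (\<exists>\<mu> :: nat \<Rightarrow> nat. strict_mono \<mu> \<and> (\<forall>k. T_seq n k \<in> \<T> (\<mu> k)))"
proof -
  note n = assms
  define \<T> where "\<T> m = tets (run_mesh n m)" for m
  define \<Omega> where "\<Omega> = interior (T_seq n 0)"
  note ind = labelled_vertices_independent[OF n]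
  have tet: "tetrahedron (T_seq n 0)"
    unfolding T_seq_hull using ind[of 0] by (intro simplex_convex_hull) simp
  have cl: "T_seq n 0 = closure \<Omega>"
  proof -
    have "closure (interior (T_seq n 0)) = closure (T_seq n 0)"
      using independent_hull_interior[of "labelled_vertices n 0"] ind[of 0]
      by (intro convex_closure_interior) (simp_all add: T_seq_hull)
    then show ?thesis using closed_simplex[OF tet] by (simp add: \<Omega>_def)
  qed
  have mesh: "simplicial_mesh (T_seq n 0) (run_mesh n m)" for m using run_invariant[OF n] by blast
  obtain A B where AB: "\<And>m. longest_edge (A m) (B m) (run_mesh n m)"
    and step: "\<And>m. run_mesh n (Suc m) = subdivide n (A m) (B m) (run_mesh n m)"
    and lim: "(\<lambda>m. dist (A m) (B m)) \<longlonglongrightarrow> 0"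
    using run_longest_edges[OF n] by metis
  have part: "tetrahedral_partition \<Omega> (\<T> m)" "conforming (\<T> m)" for m
    unfolding \<T>_def using simplicial_mesh_partition[OF mesh cl] by blast+
  have nest: "nested \<T>"
    unfolding nested_def \<T>_def step using subdivide_nested by blast
  have LE: "LE_step n (\<T> m) (\<T> (Suc m))" for m
    unfolding \<T>_def step by (rule LE_step_subdivide[OF mesh AB])
  have size: "(\<lambda>m. mesh_size (\<T> m)) \<longlonglongrightarrow> 0"
    unfolding \<T>_def
    by (rule tendsto_sandwich[OF always_eventually always_eventually tendsto_const lim])
      (use mesh_size_tets[OF mesh AB] in blast)+
  define \<mu> where "\<mu> k = (LEAST m. target n m = k)" for k
  have \<mu>: "target n (\<mu> k) = k" for k
    unfolding \<mu>_def using target_reaches[OF n, of k] by (rule LeastI_ex)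
  have "strict_mono \<mu>"
  proof (rule strict_monoI)
    fix j k :: nat assume "j < k"
    then show "\<mu> j < \<mu> k"
      using monoD[OF target_mono[OF n], of "\<mu> k" "\<mu> j"] \<mu> by (metis leD not_le_imp_less)
  qed
  have mem: "T_seq n k \<in> \<T> (\<mu> k)" for k
    unfolding \<T>_def tets_def T_seq_hull using run_invariant[OF n, of "\<mu> k"] \<mu> by auto
  show ?thesis
  proof (rule exI[of _ \<Omega>], rule exI[of _ \<T>], intro conjI)
    show "\<exists>T. tetrahedron T \<and> \<Omega> = interior T" using tet \<Omega>_def by blast
    show "\<forall>m. tetrahedral_partition \<Omega> (\<T> m) \<and> conforming (\<T> m)" using part by blast
    show "nested \<T>" by (rule nest)
    show "LE_algorithm_run n \<Omega> \<T>" unfolding LE_algorithm_run_def using part LE by blast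
    show "(\<lambda>m. mesh_size (\<T> m)) \<longlonglongrightarrow> 0" by (rule size)
    show "\<not> (\<exists>C. \<forall>m. \<forall>T\<in>\<T> m. diameter T / inradius T \<le> C)"
      using T_seq_not_shape_regular[OF n] mem by (meson not_le)
    show "\<not> (\<exists>\<alpha>\<^sub>0>0. \<forall>m. \<forall>T\<in>\<T> m. \<forall>\<theta>\<in>angles T. \<theta> \<ge> \<alpha>\<^sub>0)"
      using T_seq_small_angle[OF n] mem by (meson not_le)
    show "\<not> (\<exists>\<alpha>\<^sub>1<pi. \<forall>m. \<forall>T\<in>\<T> m. \<forall>\<theta>\<in>angles T. \<theta> \<le> \<alpha>\<^sub>1)"
      using T_seq_large_angle[OF n] mem by (meson not_le)
    show "\<exists>\<mu> :: nat \<Rightarrow> nat. strict_mono \<mu> \<and> (\<forall>k. T_seq n k \<in> \<T> (\<mu> k))"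
      using \<open>strict_mono \<mu>\<close> mem by blast
  qed
qed

end
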